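(* Suppose that for each sign $\nu\in\{+,-\}$ the coefficients satisfy $\alpha_0^\nu\ge 0$, $\alpha_0^\nu+|\beta_0^\nu|>0$, $\nu\beta_0^\nu\ge 0$ (that is, $\beta_0^+\ge 0$ and $\beta_0^-\le 0$), and $$\left(\frac{\sum_{i=1}^{m^\nu}|\alpha_i^\nu|}{\alpha_0^\nu}\right)^2+\left(\frac{\sum_{i=1}^{m^\nu}|\beta_i^\nu|}{\beta_0^\nu}\right)^2<1,$$ with the convention that if a denominator is zero then the corresponding numerator must also be zero and the corresponding fraction is omitted. Then the spectrum $\sigma$ of the multi-point eigenvalue problem consists of a strictly increasing sequence of real eigenvalues $\lambda_k\ge 0$, $k=0,1,\dots$, such that $\lim_{k\to\infty}\lambda_k=\infty$. For each $k\ge 0$: (a) $\lambda_k$ has geometric multiplicity $1$; (b) $\lambda_k$ has an eigenfunction $u_k$ such that $(\lambda_k,u_k)\in P_k^+$. In the Neumann-type case (that is, when $\alpha_0^-=\alpha_0^+=0$) $\lambda_0=0$, while if $\alpha_0^-+\alpha_0^+>0$ then $\lambda_0>0$.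
   Context: Data: integers $m^\pm\ge 1$; for each sign $\nu\in\{+,-\}$, numbers $\alpha_0^\nu,\beta_0^\nu\in\mathbb{R}$, $\alpha_i^\nu,\beta_i^\nu\in\mathbb{R}$ and $\eta_i^\nu\in[-1,1]$, $i=1,\dots,m^\nu$, with $\eta_i^+\ne 1$ and $\eta_i^-\neq -1$. The eigenvalue problem is $$-u''=\lambda u\ \text{ on }(-1,1),\qquad \alpha_0^\pm u(\pm1)+\beta_0^\pm u'(\pm 1)=\sum_{i=1}^{m^\pm}\alpha_i^\pm u(\eta_i^\pm)+\sum_{i=1}^{m^\pm}\beta_i^\pm u'(\eta_i^\pm)$$ (two boundary conditions, one for each sign), with $\lambda\in\mathbb{R}$, $u\in C^2[-1,1]$ real-valued. An eigenvalue is a $\lambda\in\mathbb R$ for which there is a non-trivial solution $u$ (an eigenfunction); the spectrum $\sigma$ is the set of eigenvalues; the geometric multiplicity of $\lambda$ is the dimension of the space of solutions. Prüfer angle and the sets $P_k^+$: let $C^1_{\rm s}[-1,1]$ be the set of $u\in C^1[-1,1]$ having only simple zeros, that is, $|u(x)|+|u'(x)|>0$ for all $x\in[-1,1]$. For $\lambda>0$ and $u\in C^1_{\rm s}[-1,1]$, the (modified) Prüfer angle $\omega_{(\lambda,u)}\in C^0[-1,1]$ is defined by $$\omega_{(\lambda,u)}(-1)\in[0,\pi),\qquad \omega_{(\lambda,u)}(x):=\tan^{-1}\frac{\lambda^{1/2}u(x)}{u'(x)},\quad x\in[-1,1],$$ where, when $u'(x)=0$, the value of $\omega_{(\lambda,u)}(x)$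 is defined by continuity. Geometrically, $\omega_{(\lambda,u)}(x)$ is regarded as the angle between the vectors $(u'(x),\lambda^{1/2}u(x))$ and $(1,0)$ in $\mathbb{R}^2$, defined to vary continuously with respect to $x$ (so it need not lie within $[0,\pi/2]$, or even within $[0,2\pi]$). For $\lambda>0$ define also the angles $$\omega_{\lambda,0}^-:=-\tan^{-1}\frac{\lambda^{1/2}\beta_0^-}{\alpha_0^-}\in[0,\pi/2],\qquad \omega_{\lambda,0}^+:=-\tan^{-1}\frac{\lambda^{1/2}\beta_0^+}{\alpha_0^+}\in[\pi/2,\pi],$$ the values of $\tan^{-1}$ being chosen so that the angles lie in the stated ranges (with value $\pi/2$ when the denominator is zero). For $k\ge 0$, $P_k^+$ is the set of $(\lambda,u)\in(0,\infty)\times C^1_{\rm s}[-1,1]$ for which $$|\omega_{(\lambda,u)}(-1)-\omega_{\lambda,0}^-|<\pi/2,\qquad |\omega_{(\lambda,u)}(1)-\omega_{\lambda,0}^+-k\pi|<\pi/2 .$$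
   Formalization: Claim (b) is stated only for λ_k > 0 (it cannot hold for λ_0 = 0), and in P_k^+ the normalization ω(-1) ∈ [0,π) is dropped: the Prüfer angle is any continuous determination (mod π) meeting both inequalities, since with the normalization (b) can fail. *)

theory Defs
  imports "HOL-Analysis.Analysis" "HOL-Library.Function_Algebras"
begin

text \<open>
  Functions on \<open>[-1,1]\<close> are represented by functions on all of \<open>real\<close>; derivatives are taken
  within \<open>[-1,1]\<close>, hence are one-sided at the end points, and nothing depends on values outside
  the interval.
\<close>

definition dI :: "(real \<Rightarrow> real) \<Rightarrow> real \<Rightarrow> real" where
  "dI u x = vector_derivative u (at x within {-1..1})"

definition C1_I :: "(real \<Rightarrow> real) set" where
  "C1_I = {u. u differentiable_on {-1..1} \<and> continuous_on {-1..1} (dI u)}"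

definition C2_I :: "(real \<Rightarrow> real) set" where
  "C2_I = {u. u \<in> C1_I \<and> dI u \<in> C1_I}"

definition C1_simple :: "(real \<Rightarrow> real) set" where
  "C1_simple = {u \<in> C1_I. \<forall>x\<in>{-1..1}. \<bar>u x\<bar> + \<bar>dI u x\<bar> > 0}"

datatype sign = Minus | Plus

primrec sgnval :: "sign \<Rightarrow> real" where
  "sgnval Minus = -1"
| "sgnval Plus = 1"

definition boundary_cond ::
  "(sign \<Rightarrow> nat) \<Rightarrow> (sign \<Rightarrow> nat \<Rightarrow> real) \<Rightarrow> (sign \<Rightarrow> nat \<Rightarrow> real) \<Rightarrow> (sign \<Rightarrow> nat \<Rightarrow> real)
    \<Rightarrow> sign \<Rightarrow> (real \<Rightarrow> real) \<Rightarrow> bool" where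
  "boundary_cond m \<alpha> \<beta> \<eta> \<nu> u \<longleftrightarrow>
     \<alpha> \<nu> 0 * u (sgnval \<nu>) + \<beta> \<nu> 0 * dI u (sgnval \<nu>)
       = (\<Sum>i=1..m \<nu>. \<alpha> \<nu> i * u (\<eta> \<nu> i)) + (\<Sum>i=1..m \<nu>. \<beta> \<nu> i * dI u (\<eta> \<nu> i))"

text \<open>
  Solutions are required to vanish outside \<open>[-1,1]\<close>, so that each function on the interval has
  exactly one representative; otherwise the dimension of the solution space would be infinite.
\<close>

definition solutions ::
  "(sign \<Rightarrow> nat) \<Rightarrow> (sign \<Rightarrow> nat \<Rightarrow> real) \<Rightarrow> (sign \<Rightarrow> nat \<Rightarrow> real) \<Rightarrow> (sign \<Rightarrow> nat \<Rightarrow> real)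
    \<Rightarrow> real \<Rightarrow> (real \<Rightarrow> real) set" where
  "solutions m \<alpha> \<beta> \<eta> lam =
     {u \<in> C2_I. (\<forall>x. x \<notin> {-1..1} \<longrightarrow> u x = 0)
        \<and> (\<forall>x\<in>{-1<..<1}. - dI (dI u) x = lam * u x)
        \<and> (\<forall>\<nu>. boundary_cond m \<alpha> \<beta> \<eta> \<nu> u)}"

definition eigenfunctions ::
  "(sign \<Rightarrow> nat) \<Rightarrow> (sign \<Rightarrow> nat \<Rightarrow> real) \<Rightarrow> (sign \<Rightarrow> nat \<Rightarrow> real) \<Rightarrow> (sign \<Rightarrow> nat \<Rightarrow> real)
    \<Rightarrow> real \<Rightarrow> (real \<Rightarrow> real) set" where
  "eigenfunctions m \<alpha> \<beta> \<eta> lam = {u \<in> solutions m \<alpha> \<beta> \<eta> lam. \<exists>x\<in>{-1..1}. u x \<noteq> 0}"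

definition spectrum_mp ::
  "(sign \<Rightarrow> nat) \<Rightarrow> (sign \<Rightarrow> nat \<Rightarrow> real) \<Rightarrow> (sign \<Rightarrow> nat \<Rightarrow> real) \<Rightarrow> (sign \<Rightarrow> nat \<Rightarrow> real)
    \<Rightarrow> real set" where
  "spectrum_mp m \<alpha> \<beta> \<eta> = {lam. eigenfunctions m \<alpha> \<beta> \<eta> lam \<noteq> {}}"

global_interpretation fun_vs: vector_space "\<lambda>(c::real) (f::real \<Rightarrow> real) x. c * f x"
  by unfold_locales (auto simp: fun_eq_iff algebra_simps)

definition geom_mult ::
  "(sign \<Rightarrow> nat) \<Rightarrow> (sign \<Rightarrow> nat \<Rightarrow> real) \<Rightarrow> (sign \<Rightarrow> nat \<Rightarrow> real) \<Rightarrow> (sign \<Rightarrow> nat \<Rightarrow> real)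
    \<Rightarrow> real \<Rightarrow> nat" where
  "geom_mult m \<alpha> \<beta> \<eta> lam = fun_vs.dim (solutions m \<alpha> \<beta> \<eta> lam)"

text \<open>
  A continuous determination on \<open>[-1,1]\<close> of the angle \<open>arctan (sqrt lam * u / u')\<close>.  Where
  \<open>u' = 0\<close> the inverse tangent is an odd multiple of \<open>\<pi>/2\<close>, and elsewhere \<open>cos \<omega> \<noteq> 0\<close> has to be
  demanded because of the totalised \<open>tan\<close> and \<open>/\<close>.

  Such an \<open>\<omega>\<close> is unique up to adding a constant integer multiple of \<open>\<pi>\<close>.  The usual
  normalisation \<open>\<omega> (-1) \<in> [0,\<pi>)\<close> is not imposed: in \<open>P_plus\<close> the multiple is fixed by the
  inequality at \<open>-1\<close>, which confines \<open>\<omega> (-1)\<close> to an open interval of length \<open>\<pi>\<close> around an angle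
  in \<open>[0,\<pi>/2]\<close> and thus allows slightly negative values of \<open>\<omega> (-1)\<close>.  These do occur for
  eigenfunctions.  For \<open>u(-1) = -u(0)/2\<close>, \<open>u(1) = 0\<close> the least eigenvalue is \<open>s\<^sup>2\<close> with
  \<open>cos s = -1/4\<close>, \<open>\<pi>/2 < s < \<pi>\<close>, and its eigenfunction \<open>sin (s * (1 - x))\<close> has \<open>u(-1) < 0 < u'(-1)\<close>:
  the determination \<open>s * (x - 1) + \<pi>\<close> satisfies both inequalities with \<open>k = 0\<close>, whereas the one
  that starts in \<open>[0,\<pi>)\<close> starts above \<open>\<pi>/2\<close> and violates the inequality at \<open>-1\<close>.
\<close>

definition prufer_angle :: "real \<Rightarrow> (real \<Rightarrow> real) \<Rightarrow> (real \<Rightarrow> real) \<Rightarrow> bool" where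
  "prufer_angle lam u \<omega> \<longleftrightarrow> continuous_on {-1..1} \<omega> \<and>
     (\<forall>x\<in>{-1..1}. if dI u x = 0 then cos (\<omega> x) = 0
                   else cos (\<omega> x) \<noteq> 0 \<and> tan (\<omega> x) = sqrt lam * u x / dI u x)"

text \<open>
  The values of \<open>-arctan (sqrt lam * \<beta>\<^sub>0 / \<alpha>\<^sub>0)\<close> that lie in \<open>[0,\<pi>/2]\<close> for the sign \<open>Minus\<close> and in
  \<open>[\<pi>/2,\<pi>]\<close> for the sign \<open>Plus\<close>, under the sign conditions \<open>\<alpha>\<^sub>0 \<ge> 0\<close> and \<open>\<nu> \<beta>\<^sub>0 \<ge> 0\<close>.
\<close>

definition angle0 ::
  "(sign \<Rightarrow> nat \<Rightarrow> real) \<Rightarrow> (sign \<Rightarrow> nat \<Rightarrow> real) \<Rightarrow> real \<Rightarrow> sign \<Rightarrow> real" where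
  "angle0 \<alpha> \<beta> lam \<nu> =
     (if \<alpha> \<nu> 0 = 0 then pi / 2
      else case \<nu> of Minus \<Rightarrow> - arctan (sqrt lam * \<beta> Minus 0 / \<alpha> Minus 0)
                   | Plus \<Rightarrow> pi - arctan (sqrt lam * \<beta> Plus 0 / \<alpha> Plus 0))"

definition P_plus ::
  "(sign \<Rightarrow> nat \<Rightarrow> real) \<Rightarrow> (sign \<Rightarrow> nat \<Rightarrow> real) \<Rightarrow> nat \<Rightarrow> (real \<times> (real \<Rightarrow> real)) set" where
  "P_plus \<alpha> \<beta> k =
     {(lam, u). lam > 0 \<and> u \<in> C1_simple \<and>
        (\<exists>\<omega>. prufer_angle lam u \<omega>
           \<and> \<bar>\<omega> (-1) - angle0 \<alpha> \<beta> lam Minus\<bar> < pi / 2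
           \<and> \<bar>\<omega> 1 - angle0 \<alpha> \<beta> lam Plus - real k * pi\<bar> < pi / 2)}"

text \<open>
  Since \<open>x / 0 = 0\<close>, a fraction with denominator zero is omitted from the sum; the convention
  that its numerator must then vanish is stated separately.
\<close>

definition coeff_cond ::
  "(sign \<Rightarrow> nat) \<Rightarrow> (sign \<Rightarrow> nat \<Rightarrow> real) \<Rightarrow> (sign \<Rightarrow> nat \<Rightarrow> real) \<Rightarrow> sign \<Rightarrow> bool" where
  "coeff_cond m \<alpha> \<beta> \<nu> \<longleftrightarrow>
     (\<alpha> \<nu> 0 = 0 \<longrightarrow> (\<Sum>i=1..m \<nu>. \<bar>\<alpha> \<nu> i\<bar>) = 0) \<and>
     (\<beta> \<nu> 0 = 0 \<longrightarrow> (\<Sum>i=1..m \<nu>. \<bar>\<beta> \<nu> i\<bar>) = 0) \<and>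
     ((\<Sum>i=1..m \<nu>. \<bar>\<alpha> \<nu> i\<bar>) / \<alpha> \<nu> 0)\<^sup>2 + ((\<Sum>i=1..m \<nu>. \<bar>\<beta> \<nu> i\<bar>) / \<beta> \<nu> 0)\<^sup>2 < 1"

end

theory Submission
  imports Defs
begin

text \<open>
  For \<open>\<lambda> = s\<^sup>2 > 0\<close> the solutions of the equation are the functions \<open>r * sin (s * x + \<phi>)\<close>.  For fixed
  \<open>s\<close>, the condition at one end is linear in the pair of coefficients and does not vanish
  identically, because the nodes can never outweigh the end point: by Cauchy-Schwarz the hypothesis
  on the coefficients gives \<open>\<Sum>\<bar>\<alpha>\<^sub>i\<bar> + s * \<Sum>\<bar>\<beta>\<^sub>i\<bar> < sqrt (\<alpha>\<^sub>0\<^sup>2 + (s * \<beta>\<^sub>0)\<^sup>2)\<close> (\<open>coeff_sum_less_amp\<close>).  Hence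
  each end selects exactly one phase modulo \<open>\<pi>\<close>, and that phase has a unique representative
  \<open>phase s\<close> within \<open>\<pi>/2\<close> of the one belonging to the local condition
  \<open>\<alpha>\<^sub>0 * u + \<beta>\<^sub>0 * u' = 0\<close> (\<open>bc_zero_iff\<close>, \<open>phase_near_base\<close>).  Measured from its own end point and
  directed inwards, each of the two phases is a differentiable function of \<open>s\<close>.

  The two conditions are compatible exactly when the two phases agree modulo \<open>\<pi>\<close>, that is, when
  \<open>gap s = 2 * s + phase\<^sup>- s + phase\<^sup>+ s - \<pi>\<close> is a multiple of \<open>\<pi>\<close>; there is then only one solution up
  to a factor.  If \<open>gap s = k * \<pi>\<close>, the angle \<open>s * (x + 1) + phase\<^sup>- s\<close> of the eigenfunction
  starts within \<open>\<pi>/2\<close> of the local angle at \<open>-1\<close> and ends within \<open>\<pi>/2\<close> of the local angle at \<open>1\<close>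
  plus \<open>k * \<pi>\<close>, which is membership in the \<open>k\<close>-th Pruefer class.

  The heart of the matter is that \<open>gap\<close> is strictly increasing, for which it suffices that each
  phase has derivative greater than \<open>-1\<close> (\<open>phase_derivative_gt\<close>).  This is an estimate of complex
  numbers: the nodes contribute numbers \<open>w\<^sub>i\<close> of modulus at most \<open>\<bar>\<alpha>\<^sub>i\<bar> + s * \<bar>\<beta>\<^sub>i\<bar>\<close>, the end point
  contributes one number of larger modulus than all of them together, and the boundary condition
  says that the imaginary parts balance; so the real parts at the nodes are dominated by that at
  the end point, even when they are weighted by factors from \<open>[-1,1]\<close> (\<open>re_parts_at_phase\<close>).  The
  factor \<open>s\<close> in front of the derivative terms adds one further contribution, which is
  nonnegative by a second Cauchy-Schwarz estimate (\<open>derivative_terms_nonneg\<close>).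

  Finally \<open>gap 0\<close> is \<open>-\<pi>\<close>, \<open>-\<pi>/2\<close> or \<open>0\<close>, the last in the Neumann-type case only, and
  \<open>gap s \<ge> 2 * s - 2 * \<pi>\<close>.  So every \<open>k * \<pi>\<close> with \<open>k \<ge> 0\<close> is attained at exactly one \<open>s \<ge> 0\<close>, negative
  multiples are attained for no \<open>s > 0\<close>, and \<open>s = 0\<close> occurs only for \<open>k = 0\<close> in the Neumann-type
  case.  For \<open>\<lambda> \<le> 0\<close> the energy \<open>u'\<^sup>2 + \<lambda> * u\<^sup>2\<close> is constant, so \<open>\<bar>u\<bar>\<close> and \<open>\<bar>u'\<bar>\<close> are largest at a common
  end point; there the boundary condition leaves only constant functions, with \<open>\<lambda> = 0\<close> and
  \<open>\<alpha>\<^sub>0 = 0\<close> at both ends (\<open>nonpositive_eigenfunction\<close>).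
\<close>

section \<open>The phase selected by one boundary condition\<close>

text \<open>
  A boundary condition as seen from its own end point: \<open>\<tau> i\<close> is the distance of the \<open>i\<close>-th node,
  and the derivative terms have the signs that they get when derivatives are taken inwards, with
  \<open>b0\<close> standing for \<open>\<bar>\<beta>\<^sub>0\<bar>\<close>.  This form covers both ends, the right one after the reflection
  \<open>x \<mapsto> -x\<close>.
\<close>

locale boundary_phase =
  fixes n :: nat and a0 b0 :: real and a b \<tau> :: "nat \<Rightarrow> real"
  assumes a0_nonneg: "0 \<le> a0" and b0_nonneg: "0 \<le> b0" and a0_b0_pos: "0 < a0 + b0"
    and shift_range: "\<And>i. i \<in> {1..n} \<Longrightarrow> \<tau> i \<in> {0..2}"
    and a_degenerate: "a0 = 0 \<Longrightarrow> (\<Sum>i=1..n. \<bar>a i\<bar>) = 0"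
    and b_degenerate: "b0 = 0 \<Longrightarrow> (\<Sum>i=1..n. \<bar>b i\<bar>) = 0"
    and small: "((\<Sum>i=1..n. \<bar>a i\<bar>) / a0)\<^sup>2 + ((\<Sum>i=1..n. \<bar>b i\<bar>) / b0)\<^sup>2 < 1"
begin

text \<open>
  The factor in front of the derivative terms for the wave number \<open>s\<close>.  If \<open>a0 = 0\<close>, only
  derivative terms are left and the condition is divided by \<open>s\<close>; in this way it
  stays nondegenerate at \<open>s = 0\<close> and the phase extends continuously to \<open>s = 0\<close>.
\<close>

definition scale :: "real \<Rightarrow> real" where
  "scale s = (if a0 = 0 then 1 else s)"

text \<open>
  The phase selected by the local condition \<open>a0 * sin x - scale s * b0 * cos x = 0\<close>.
\<close>

definition base :: "real \<Rightarrow> real" where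
  "base s = (if a0 = 0 then pi / 2 else arctan (s * b0 / a0))"

definition amp :: "real \<Rightarrow> real" where
  "amp s = sqrt (a0\<^sup>2 + (scale s * b0)\<^sup>2)"

text \<open>
  The real and imaginary parts of the contribution
  \<open>w\<^sub>i = (a i + \<i> * scale s * b i) * exp (\<i> * (x + s * \<tau> i))\<close> of the \<open>i\<close>-th node.
\<close>

definition re_part :: "real \<Rightarrow> real \<Rightarrow> nat \<Rightarrow> real" where
  "re_part s x i = a i * cos (x + s * \<tau> i) - scale s * b i * sin (x + s * \<tau> i)"

definition im_part :: "real \<Rightarrow> real \<Rightarrow> nat \<Rightarrow> real" where
  "im_part s x i = a i * sin (x + s * \<tau> i) + scale s * b i * cos (x + s * \<tau> i)"

text \<open>
  The defect of \<open>t \<mapsto> sin (x + s * t)\<close> in the boundary condition, where \<open>t\<close> is the distance from the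
  end point, and its derivative with respect to the phase \<open>x\<close>.
\<close>

definition bc :: "real \<Rightarrow> real \<Rightarrow> real" where
  "bc s x = a0 * sin x - scale s * b0 * cos x - (\<Sum>i=1..n. im_part s x i)"

definition bc_x :: "real \<Rightarrow> real \<Rightarrow> real" where
  "bc_x s x = a0 * cos x + scale s * b0 * sin x - (\<Sum>i=1..n. re_part s x i)"

text \<open>
  As a function of \<open>x\<close>, \<open>bc s x\<close> is a combination of \<open>cos (x - base s)\<close> and \<open>sin (x - base s)\<close> with
  coefficients \<open>bc s (base s)\<close> and \<open>bc_x s (base s)\<close>, so its zero next to \<open>base s\<close> has this closed
  form.  It makes differentiability in \<open>s\<close> evident.
\<close>

definition phase :: "real \<Rightarrow> real" where
  "phase s = base s - arctan (bc s (base s) / bc_x s (base s))"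

lemma scale_nonneg: "0 \<le> s \<Longrightarrow> 0 \<le> scale s"
  by (simp add: scale_def)

lemma amp_pos: "0 \<le> s \<Longrightarrow> 0 < amp s"
  using a0_nonneg a0_b0_pos by (auto simp: amp_def scale_def intro: add_pos_nonneg)

lemma amp_base:
  shows "amp s * cos (base s) = a0"
    and "amp s * sin (base s) = scale s * b0"
proof -
  have "amp s * cos (base s) = a0 \<and> amp s * sin (base s) = scale s * b0"
  proof (cases "a0 = 0")
    case True
    then show ?thesis unfolding amp_def base_def scale_def using b0_nonneg by simp
  next
    case False
    define y where "y = s * b0 / a0"
    have "a0\<^sup>2 + (s * b0)\<^sup>2 = a0\<^sup>2 * (1 + y\<^sup>2)"
      using False by (simp add: y_def field_simps)
    then have "amp s = a0 * sqrt (1 + y\<^sup>2)"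
      using False a0_nonneg by (simp add: amp_def scale_def real_sqrt_mult)
    moreover have "sqrt (1 + y\<^sup>2) \<noteq> 0"
      by (metis add_pos_nonneg less_irrefl real_sqrt_gt_0_iff zero_le_power2 zero_less_one)
    moreover have "base s = arctan y" "scale s * b0 = a0 * y"
      using False by (simp_all add: base_def scale_def y_def)
    ultimately show ?thesis by (simp add: cos_arctan sin_arctan)
  qed
  then show "amp s * cos (base s) = a0" "amp s * sin (base s) = scale s * b0" by auto
qed

text \<open>
  The end point contributes a complex number of modulus \<open>amp s\<close> and argument \<open>x - base s\<close>.
\<close>

lemma lhs_polar:
  shows lhs_re: "a0 * cos x + scale s * b0 * sin x = amp s * cos (x - base s)"
    and lhs_im: "a0 * sin x - scale s * b0 * cos x = amp s * sin (x - base s)"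
proof -
  have "amp s * cos (x - base s) = cos x * (amp s * cos (base s)) + sin x * (amp s * sin (base s))"
    by (simp add: cos_diff algebra_simps)
  then show "a0 * cos x + scale s * b0 * sin x = amp s * cos (x - base s)"
    by (simp only: amp_base mult.commute)
  have "amp s * sin (x - base s) = sin x * (amp s * cos (base s)) - cos x * (amp s * sin (base s))"
    by (simp add: sin_diff algebra_simps)
  then show "a0 * sin x - scale s * b0 * cos x = amp s * sin (x - base s)"
    by (simp only: amp_base mult.commute)
qed

lemma ratio_cancel:
  shows "(\<Sum>i=1..n. \<bar>a i\<bar>) / a0 * a0 = (\<Sum>i=1..n. \<bar>a i\<bar>)"
    and "(\<Sum>i=1..n. \<bar>b i\<bar>) / b0 * b0 = (\<Sum>i=1..n. \<bar>b i\<bar>)"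
  using a_degenerate b_degenerate by auto

lemma coeff_sum_less:
  shows "a0 \<noteq> 0 \<Longrightarrow> (\<Sum>i=1..n. \<bar>a i\<bar>) < a0" and "b0 \<noteq> 0 \<Longrightarrow> (\<Sum>i=1..n. \<bar>b i\<bar>) < b0"
proof -
  have sq: "x\<^sup>2 < 1 \<Longrightarrow> x < 1" for x :: real
    using power2_less_imp_less[of x 1] by simp
  have "((\<Sum>i=1..n. \<bar>a i\<bar>) / a0)\<^sup>2 < 1" "((\<Sum>i=1..n. \<bar>b i\<bar>) / b0)\<^sup>2 < 1"
    using small by (smt (verit) zero_le_power2)+
  then have *: "(\<Sum>i=1..n. \<bar>a i\<bar>) / a0 < 1" "(\<Sum>i=1..n. \<bar>b i\<bar>) / b0 < 1"
    using sq by blast+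
  show "(\<Sum>i=1..n. \<bar>a i\<bar>) < a0" if "a0 \<noteq> 0" using *(1) that a0_nonneg by (simp add: divide_less_eq)
  show "(\<Sum>i=1..n. \<bar>b i\<bar>) < b0" if "b0 \<noteq> 0" using *(2) that b0_nonneg by (simp add: divide_less_eq)
qed

text \<open>
  Cauchy-Schwarz, with the ratios \<open>p\<close>, \<open>q\<close> of the coefficient sums to \<open>a0\<close>, \<open>b0\<close>: the left-hand side
  is \<open>p * a0 + q * (scale s * b0)\<close>, and \<open>p\<^sup>2 + q\<^sup>2 < 1\<close>.
\<close>

lemma coeff_sum_less_amp:
  assumes "0 \<le> s"
  shows "(\<Sum>i=1..n. \<bar>a i\<bar>) + scale s * (\<Sum>i=1..n. \<bar>b i\<bar>) < amp s"
proof -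
  define p where "p = (\<Sum>i=1..n. \<bar>a i\<bar>) / a0"
  define q where "q = (\<Sum>i=1..n. \<bar>b i\<bar>) / b0"
  have amp2: "(amp s)\<^sup>2 = a0\<^sup>2 + (scale s * b0)\<^sup>2" by (simp add: amp_def)
  have "(p * a0 + q * (scale s * b0))\<^sup>2
      = (p\<^sup>2 + q\<^sup>2) * (amp s)\<^sup>2 - (p * (scale s * b0) - q * a0)\<^sup>2"
    unfolding amp2 by algebra
  also have "\<dots> \<le> (p\<^sup>2 + q\<^sup>2) * (amp s)\<^sup>2" by simp
  also have "\<dots> < 1 * (amp s)\<^sup>2"
    using small amp_pos[OF assms] by (intro mult_strict_right_mono) (auto simp: p_def q_def)
  finally have "p * a0 + q * (scale s * b0) < amp s"
    using amp_pos[OF assms] by (simp add: power2_less_imp_less)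
  moreover have "p * a0 = (\<Sum>i=1..n. \<bar>a i\<bar>)" "q * b0 = (\<Sum>i=1..n. \<bar>b i\<bar>)"
    unfolding p_def q_def by (rule ratio_cancel)+
  ultimately show ?thesis by (metis mult.left_commute)
qed

text \<open>
  The triangle inequality for the numbers \<open>\<bar>Re w\<^sub>i\<bar> + \<i> * \<bar>Im w\<^sub>i\<bar>\<close>, which have the same moduli as the
  \<open>w\<^sub>i\<close>.  Summing the absolute values of the parts is what later permits arbitrary weights
  from \<open>[-1,1]\<close>.
\<close>

lemma parts_bound:
  assumes "0 \<le> s"
  shows "(\<Sum>i=1..n. \<bar>re_part s x i\<bar>)\<^sup>2 + (\<Sum>i=1..n. \<bar>im_part s x i\<bar>)\<^sup>2 < (amp s)\<^sup>2"
proof -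
  define z where "z i = Complex \<bar>re_part s x i\<bar> \<bar>im_part s x i\<bar>" for i
  have norm_z: "norm (z i) \<le> \<bar>a i\<bar> + scale s * \<bar>b i\<bar>" for i
  proof -
    have "(re_part s x i)\<^sup>2 + (im_part s x i)\<^sup>2 = ((a i)\<^sup>2 + (scale s * b i)\<^sup>2) * ((sin (x + s * \<tau> i))\<^sup>2 + (cos (x + s * \<tau> i))\<^sup>2)"
      unfolding re_part_def im_part_def by algebra
    then have "norm (z i) = sqrt ((a i)\<^sup>2 + (scale s * b i)\<^sup>2)"
      by (simp add: z_def cmod_def)
    also have "\<dots> \<le> \<bar>a i\<bar> + \<bar>scale s * b i\<bar>" by (rule sqrt_sum_squares_le_sum_abs)
    finally show ?thesis using scale_nonneg[OF assms] by (simp add: abs_mult)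
  qed
  have "norm (\<Sum>i=1..n. z i) \<le> (\<Sum>i=1..n. \<bar>a i\<bar> + scale s * \<bar>b i\<bar>)"
    by (rule sum_norm_le) (rule norm_z)
  also have "\<dots> = (\<Sum>i=1..n. \<bar>a i\<bar>) + scale s * (\<Sum>i=1..n. \<bar>b i\<bar>)"
    by (simp add: sum.distrib sum_distrib_left)
  also have "\<dots> < amp s" by (rule coeff_sum_less_amp[OF assms])
  finally have "(norm (\<Sum>i=1..n. z i))\<^sup>2 < (amp s)\<^sup>2"
    by (simp add: power_strict_mono)
  then show ?thesis by (simp add: cmod_power2 z_def)
qed

lemma bc_shift: "bc s (x + d) = bc s x * cos d + bc_x s x * sin d"
proof -
  have "im_part s (x + d) i = cos d * im_part s x i + sin d * re_part s x i" for i
  proof -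
    have "x + d + s * \<tau> i = (x + s * \<tau> i) + d" by simp
    then show ?thesis
      unfolding im_part_def re_part_def \<open>x + d + s * \<tau> i = (x + s * \<tau> i) + d\<close>
        sin_add[of "x + s * \<tau> i" d] cos_add[of "x + s * \<tau> i" d]
      by algebra
  qed
  then show ?thesis
    unfolding bc_def bc_x_def
    by (simp add: sum.distrib sum_distrib_left[symmetric] sin_add cos_add algebra_simps)
qed

lemma bc_x_base_pos:
  assumes "0 \<le> s"
  shows "0 < bc_x s (base s)"
proof -
  have "(\<Sum>i=1..n. \<bar>re_part s (base s) i\<bar>)\<^sup>2 < (amp s)\<^sup>2"
    using parts_bound[OF assms, of "base s"]
    by (smt (verit) zero_le_power2)
  then have "(\<Sum>i=1..n. \<bar>re_part s (base s) i\<bar>) < amp s"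
    using amp_pos[OF assms] by (simp add: power2_less_imp_less)
  moreover have "(\<Sum>i=1..n. re_part s (base s) i) \<le> (\<Sum>i=1..n. \<bar>re_part s (base s) i\<bar>)"
    by (intro sum_mono) auto
  ultimately show ?thesis
    unfolding bc_x_def lhs_re by simp
qed

lemma phase_near_base: "\<bar>phase s - base s\<bar> < pi / 2"
  unfolding phase_def using arctan_bounded[of "bc s (base s) / bc_x s (base s)"] by auto

lemma bc_phase:
  assumes "0 \<le> s"
  shows "bc s (phase s) = 0"
proof -
  define y where "y = bc s (base s) / bc_x s (base s)"
  have "bc s (phase s) = bc s (base s + - arctan y)" by (simp add: phase_def y_def)
  also have "\<dots> = bc s (base s) * cos (arctan y) - bc_x s (base s) * sin (arctan y)"
    by (subst bc_shift) simp
  also have "\<dots> = 0"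
    using bc_x_base_pos[OF assms] by (simp add: y_def cos_arctan sin_arctan)
  finally show ?thesis .
qed

text \<open>
  At the phase, the imaginary part \<open>amp s * sin \<delta>\<close> of the end point equals the sum of those of the
  nodes.  Since the nodes have the smaller total modulus, what is left for their real parts is
  less than \<open>amp s * cos \<delta>\<close>, which is positive by \<open>\<bar>\<delta>\<bar> < \<pi>/2\<close>.
\<close>

lemma re_parts_at_phase:
  assumes "0 \<le> s"
  shows "(\<Sum>i=1..n. \<bar>re_part s (phase s) i\<bar>) < a0 * cos (phase s) + scale s * b0 * sin (phase s)"
proof -
  define \<delta> where "\<delta> = phase s - base s"
  have "0 < cos \<delta>"
    using phase_near_base[of s] unfolding \<delta>_def[symmetric] abs_less_iff
    by (intro cos_gt_zero_pi) linarith+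
  then have pos: "0 < amp s * cos \<delta>" using amp_pos[OF assms] by simp
  have "amp s * sin \<delta> = (\<Sum>i=1..n. im_part s (phase s) i)"
    using bc_phase[OF assms] unfolding bc_def lhs_im \<delta>_def by simp
  then have "\<bar>amp s * sin \<delta>\<bar> \<le> (\<Sum>i=1..n. \<bar>im_part s (phase s) i\<bar>)"
    by (simp add: sum_abs)
  then have "(amp s * sin \<delta>)\<^sup>2 \<le> (\<Sum>i=1..n. \<bar>im_part s (phase s) i\<bar>)\<^sup>2"
    by (metis abs_ge_zero power2_abs power_mono)
  moreover have "(amp s * sin \<delta>)\<^sup>2 + (amp s * cos \<delta>)\<^sup>2 = (amp s)\<^sup>2"
    by (simp add: power_mult_distrib distrib_left[symmetric])
  ultimately have "(\<Sum>i=1..n. \<bar>re_part s (phase s) i\<bar>)\<^sup>2 < (amp s * cos \<delta>)\<^sup>2"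
    using parts_bound[OF assms, of "phase s"] by linarith
  then show ?thesis
    unfolding lhs_re using pos by (simp add: \<delta>_def power2_less_imp_less)
qed

lemma bc_x_phase_pos: "0 \<le> s \<Longrightarrow> 0 < bc_x s (phase s)"
  using re_parts_at_phase[of s] sum_mono[of "{1..n}" "re_part s (phase s)" "\<lambda>i. \<bar>re_part s (phase s) i\<bar>"]
  unfolding bc_x_def by force

lemma bc_zero_iff:
  assumes "0 \<le> s"
  shows "bc s x = 0 \<longleftrightarrow> (\<exists>j::int. x = phase s + of_int j * pi)"
proof -
  have "bc s x = bc s (phase s + (x - phase s))" by simp
  also have "\<dots> = bc_x s (phase s) * sin (x - phase s)"
    by (subst bc_shift) (simp add: bc_phase[OF assms])
  finally have "bc s x = 0 \<longleftrightarrow> sin (x - phase s) = 0"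
    using bc_x_phase_pos[OF assms] by simp
  also have "\<dots> \<longleftrightarrow> (\<exists>j::int. x - phase s = of_int j * pi)"
    by (simp add: sin_zero_iff_int2)
  also have "\<dots> \<longleftrightarrow> (\<exists>j::int. x = phase s + of_int j * pi)"
    by (simp add: algebra_simps)
  finally show ?thesis .
qed

text \<open>
  Let \<open>h = s * b0\<close>, let \<open>p\<close>, \<open>q\<close> be the sums of the terms \<open>a i * sin\<close> and \<open>b i * cos\<close> divided by \<open>a0\<close> and
  \<open>b0\<close>, and write \<open>(a0 + \<i> * h) * exp (- \<i> * x) = P - \<i> * E\<close>.  The boundary condition says that
  \<open>E = a0 * p + h * q\<close>.  As \<open>p\<^sup>2 + q\<^sup>2 \<le> 1\<close>, the vector \<open>(h * p - a0 * q, a0 * p + h * q)\<close> is not longer than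
  \<open>(P, E)\<close>; their second components agree and \<open>P > 0\<close>, so \<open>h * p - a0 * q \<le> P\<close>.  The quantity in
  question, multiplied by \<open>s * (a0\<^sup>2 + h\<^sup>2)\<close>, turns out to be \<open>h * a0 * (P - (h * p - a0 * q))\<close>.
\<close>

lemma derivative_terms_nonneg:
  assumes "0 < s" "a0 \<noteq> 0"
  shows "0 \<le> b0 * cos (phase s) + (\<Sum>i=1..n. b i * cos (phase s + s * \<tau> i))"
proof -
  define x where "x = phase s"
  define X where "X = (\<Sum>i=1..n. a i * sin (x + s * \<tau> i))"
  define Y where "Y = (\<Sum>i=1..n. b i * cos (x + s * \<tau> i))"
  define h where "h = s * b0"
  define p where "p = X / a0"
  define q where "q = Y / b0"
  have scale: "scale s = s" using assms by (simp add: scale_def)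
  have a0: "0 < a0" using assms a0_nonneg by simp
  have absX: "\<bar>X\<bar> \<le> (\<Sum>i=1..n. \<bar>a i\<bar>)"
    unfolding X_def
    by (rule order_trans[OF sum_abs], rule sum_mono)
       (simp add: abs_mult mult_left_le)
  have absY: "\<bar>Y\<bar> \<le> (\<Sum>i=1..n. \<bar>b i\<bar>)"
    unfolding Y_def
    by (rule order_trans[OF sum_abs], rule sum_mono)
       (simp add: abs_mult mult_left_le)
  have X: "X = a0 * p" using a0 by (simp add: p_def)
  have Y: "Y = b0 * q" using absY b_degenerate by (auto simp: q_def)
  have "p\<^sup>2 \<le> ((\<Sum>i=1..n. \<bar>a i\<bar>) / a0)\<^sup>2"
    unfolding p_def using absX a0 by (intro power2_le_iff_abs_le[THEN iffD2]) (auto simp: divide_right_mono sum_nonneg)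
  moreover have "q\<^sup>2 \<le> ((\<Sum>i=1..n. \<bar>b i\<bar>) / b0)\<^sup>2"
    unfolding q_def using absY b0_nonneg by (intro power2_le_iff_abs_le[THEN iffD2]) (auto simp: divide_right_mono sum_nonneg)
  ultimately have pq: "p\<^sup>2 + q\<^sup>2 \<le> 1" using small by linarith
  have "im_part s x i = a i * sin (x + s * \<tau> i) + s * (b i * cos (x + s * \<tau> i))" for i
    by (simp add: im_part_def scale)
  then have "(\<Sum>i=1..n. im_part s x i) = X + s * Y"
    by (simp add: X_def Y_def sum.distrib sum_distrib_left)
  then have eq: "a0 * sin x - h * cos x = a0 * p + h * q"
    using bc_phase[of s] assms by (simp add: bc_def x_def scale h_def X Y algebra_simps)
  have "(h * p - a0 * q)\<^sup>2 + (a0 * p + h * q)\<^sup>2 = (a0\<^sup>2 + h\<^sup>2) * (p\<^sup>2 + q\<^sup>2)" by algebra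
  also have "\<dots> \<le> (a0\<^sup>2 + h\<^sup>2) * 1" using pq by (intro mult_left_mono) auto
  also have "\<dots> = (a0\<^sup>2 + h\<^sup>2) * ((sin x)\<^sup>2 + (cos x)\<^sup>2)" by simp
  also have "\<dots> = (a0 * cos x + h * sin x)\<^sup>2 + (a0 * sin x - h * cos x)\<^sup>2" by algebra
  finally have "(h * p - a0 * q)\<^sup>2 \<le> (a0 * cos x + h * sin x)\<^sup>2" by (simp add: eq)
  moreover have pos: "0 < a0 * cos x + h * sin x"
  proof -
    have "0 \<le> (\<Sum>i=1..n. \<bar>re_part s x i\<bar>)" by (simp add: sum_nonneg)
    then show ?thesis
      using re_parts_at_phase[of s] assms unfolding x_def h_def scale by linarith
  qed
  ultimately have le: "h * p - a0 * q \<le> a0 * cos x + h * sin x"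
    using abs_le_square_iff[of "h * p - a0 * q" "a0 * cos x + h * sin x"] by simp
  have "(a0\<^sup>2 + h\<^sup>2) * (h * cos x + h * q) = h * a0 * ((a0 * cos x + h * sin x) - (h * p - a0 * q))"
    using eq by algebra
  moreover have "0 \<le> h * a0" using assms b0_nonneg a0 by (simp add: h_def)
  ultimately have "0 \<le> (a0\<^sup>2 + h\<^sup>2) * (h * cos x + h * q)" using le by simp
  moreover have "0 < a0\<^sup>2 + h\<^sup>2" using a0 by (simp add: add_pos_nonneg)
  ultimately have "0 \<le> h * cos x + h * q" by (simp add: zero_le_mult_iff)
  then have "0 \<le> s * (b0 * cos x + Y)" by (simp add: h_def Y algebra_simps)
  then have "0 \<le> b0 * cos x + Y" using assms by (simp add: zero_le_mult_iff)
  then show ?thesis by (simp add: x_def Y_def)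
qed

definition scale' :: real where "scale' = (if a0 = 0 then 0 else 1)"

lemma scale_deriv: "(scale has_real_derivative scale') (at s)"
proof -
  have "scale = (\<lambda>s. if a0 = 0 then 1 else s)" by (auto simp: scale_def)
  then show ?thesis unfolding scale'_def by (cases "a0 = 0") simp_all
qed

text \<open>
  The total derivative, arranged so that the contribution of the factor \<open>scale s\<close> stands apart: along
  the phase its sign is the one found in \<open>derivative_terms_nonneg\<close>.
\<close>

lemma bc_along_curve:
  assumes "(f has_real_derivative f') (at s)"
  shows "((\<lambda>s. bc s (f s)) has_real_derivative
     bc_x s (f s) * f' - (\<Sum>i=1..n. \<tau> i * re_part s (f s) i)
      - scale' * (b0 * cos (f s) + (\<Sum>i=1..n. b i * cos (f s + s * \<tau> i)))) (at s)"
proof -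
  have im: "((\<lambda>s. im_part s (f s) i) has_real_derivative
      (re_part s (f s) i * f' + \<tau> i * re_part s (f s) i + scale' * (b i * cos (f s + s * \<tau> i)))) (at s)" for i
    unfolding im_part_def re_part_def
    by (rule derivative_eq_intros assms scale_deriv refl)+ (simp add: algebra_simps)
  show ?thesis
    unfolding bc_def bc_x_def
    by (rule derivative_eq_intros assms scale_deriv refl DERIV_sum im)+
       (simp add: algebra_simps sum.distrib flip: sum_distrib_left)
qed

lemma base_differentiable: "\<exists>d. (base has_real_derivative d) (at s)"
proof (cases "a0 = 0")
  case True
  then have "base = (\<lambda>s. pi / 2)" unfolding base_def by simp
  then show ?thesis using DERIV_const by metis
next
  case False
  then have "base = (\<lambda>s. arctan (s * b0 / a0))" by (auto simp: base_def)
  moreover have "\<exists>d. ((\<lambda>s. arctan (s * b0 / a0)) has_real_derivative d) (at s)"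
    by (rule exI, (rule derivative_eq_intros refl)+) (use False in auto)
  ultimately show ?thesis by simp
qed

lemma phase_differentiable:
  assumes "0 \<le> s"
  shows "\<exists>d. (phase has_real_derivative d) (at s)"
proof -
  obtain d where d: "(base has_real_derivative d) (at s)" using base_differentiable by blast
  \<comment> \<open>\<open>bc_x s x = bc s (x + \<pi>/2)\<close>, so the derivative along a curve is known for the denominator as well.\<close>
  have "((\<lambda>s. base s + pi / 2) has_real_derivative d) (at s)"
    by (auto intro!: derivative_eq_intros d)
  from bc_along_curve[OF this] obtain e where e: "((\<lambda>s. bc s (base s + pi / 2)) has_real_derivative e) (at s)"
    by blast
  have "bc s (base s + pi / 2) = bc_x s (base s)" for s by (simp add: bc_shift)
  with e have e: "((\<lambda>s. bc_x s (base s)) has_real_derivative e) (at s)" by simp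
  from bc_along_curve[OF d] obtain e' where e': "((\<lambda>s. bc s (base s)) has_real_derivative e') (at s)"
    by blast
  have "bc_x s (base s) \<noteq> 0" using bc_x_base_pos[OF assms] by simp
  then show ?thesis
    unfolding phase_def[abs_def]
    using DERIV_diff[OF d DERIV_chain2[OF DERIV_arctan DERIV_divide[OF e' e]]] by blast
qed

text \<open>
  Differentiating \<open>bc s (phase s) = 0\<close> yields \<open>bc_x * d = \<Sum>\<tau>\<^sub>i * Re w\<^sub>i + N\<close> with \<open>N \<ge> 0\<close>.  Adding
  \<open>bc_x\<close> to both sides replaces the weights \<open>\<tau>\<^sub>i \<in> [0,2]\<close> by \<open>\<tau>\<^sub>i - 1 \<in> [-1,1]\<close>, for which the real parts
  of the nodes are dominated by that of the end point.
\<close>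

lemma phase_derivative_gt:
  assumes "0 < s" and d: "(phase has_real_derivative d) (at s)"
  shows "-1 < d"
proof -
  let ?T = "b0 * cos (phase s) + (\<Sum>i=1..n. b i * cos (phase s + s * \<tau> i))"
  have zero: "bc_x s (phase s) * d - (\<Sum>i=1..n. \<tau> i * re_part s (phase s) i) - scale' * ?T = 0"
  proof (rule DERIV_unique[OF bc_along_curve[OF d]])
    have "eventually (\<lambda>t. t \<in> {0<..}) (nhds s)"
      using assms by (intro eventually_nhds_in_open) auto
    then have "eventually (\<lambda>t. 0 = bc t (phase t)) (nhds s)"
      by eventually_elim (simp add: bc_phase)
    then show "((\<lambda>s. bc s (phase s)) has_real_derivative 0) (at s)"
      using DERIV_cong_ev[OF refl _ refl, of "\<lambda>_. 0" "\<lambda>t. bc t (phase t)" s 0] by simp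
  qed
  have T: "0 \<le> scale' * ?T"
    using derivative_terms_nonneg[OF assms(1)] by (auto simp: scale'_def)
  have "(\<Sum>i=1..n. (1 - \<tau> i) * re_part s (phase s) i) \<le> (\<Sum>i=1..n. \<bar>re_part s (phase s) i\<bar>)"
  proof (rule sum_mono)
    fix i assume "i \<in> {1..n}"
    then have "\<bar>1 - \<tau> i\<bar> \<le> 1" using shift_range[of i] by auto
    then have "\<bar>1 - \<tau> i\<bar> * \<bar>re_part s (phase s) i\<bar> \<le> 1 * \<bar>re_part s (phase s) i\<bar>"
      by (intro mult_right_mono) auto
    then show "(1 - \<tau> i) * re_part s (phase s) i \<le> \<bar>re_part s (phase s) i\<bar>"
      by (simp add: abs_mult[symmetric])
  qed
  then have "0 < bc_x s (phase s) + (\<Sum>i=1..n. \<tau> i * re_part s (phase s) i)"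
    using re_parts_at_phase[of s] assms(1)
    by (simp add: bc_x_def left_diff_distrib sum_subtractf)
  with zero T have "0 < bc_x s (phase s) * (d + 1)" by (simp add: algebra_simps)
  then show ?thesis
    using bc_x_phase_pos[of s] assms(1) by (simp add: zero_less_mult_iff)
qed

lemma base_range: "0 \<le> s \<Longrightarrow> 0 \<le> base s \<and> base s \<le> pi / 2"
  using a0_nonneg b0_nonneg arctan_ubound[of "s * b0 / a0"] by (auto simp: base_def less_imp_le)

text \<open>
  At \<open>s = 0\<close> all nodes merge with the end point, and the condition contains either only sines or only
  cosines of the phase itself; so the local phase solves it.
\<close>

lemma phase_0: "phase 0 = (if a0 = 0 then pi / 2 else 0)"
proof -
  have "im_part 0 (base 0) i = 0" if "i \<in> {1..n}" for i
  proof (cases "a0 = 0")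
    case True
    then have "(\<Sum>i=1..n. \<bar>a i\<bar>) = 0" by (rule a_degenerate)
    with that have "a i = 0" by (simp add: sum_nonneg_eq_0_iff)
    then show ?thesis using True unfolding im_part_def base_def by simp
  qed (simp add: im_part_def base_def scale_def)
  then have "bc 0 (base 0) = 0" by (simp add: bc_def base_def scale_def)
  then show ?thesis by (simp add: phase_def base_def)
qed

end

section \<open>Derivatives on the interval and solutions of the equation\<close>

lemma dI_eqI:
  assumes "(u has_real_derivative d) (at x within {-1..1})" "x \<in> {-1..1}"
  shows "dI u x = d"
proof -
  have "(u has_vector_derivative d) (at x within cbox (-1) 1)"
    using assms(1) by (simp add: has_real_derivative_iff_has_vector_derivative)
  with assms(2) show ?thesis
    unfolding dI_def using vector_derivative_within_cbox[of "-1" 1 x u d] by simp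
qed

lemma dI_works:
  assumes "u \<in> C1_I" "x \<in> {-1..1}"
  shows "(u has_real_derivative dI u x) (at x within {-1..1})"
proof -
  have "u differentiable (at x within {-1..1})"
    using assms by (auto simp: C1_I_def differentiable_on_def)
  then show ?thesis
    by (simp add: dI_def has_real_derivative_iff_has_vector_derivative vector_derivative_works)
qed

lemma C1_I_I:
  assumes "\<And>x. x \<in> {-1..1} \<Longrightarrow> (u has_real_derivative u' x) (at x within {-1..1})"
    and "continuous_on {-1..1} u'"
  shows "u \<in> C1_I"
proof -
  have "continuous_on {-1..1} (dI u)"
    using assms(2) continuous_on_cong[of "{-1..1}" "{-1..1}" "dI u" u'] dI_eqI[OF assms(1)] by blast
  moreover have "u differentiable_on {-1..1}"
    unfolding differentiable_on_def
    using assms(1) real_differentiable_def by blast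
  ultimately show ?thesis by (simp add: C1_I_def)
qed

lemma C2_I_I:
  assumes u: "\<And>x. x \<in> {-1..1} \<Longrightarrow> (u has_real_derivative u' x) (at x within {-1..1})"
    and u': "\<And>x. x \<in> {-1..1} \<Longrightarrow> (u' has_real_derivative u'' x) (at x within {-1..1})"
    and "continuous_on {-1..1} u''"
  shows "u \<in> C2_I" "\<And>x. x \<in> {-1..1} \<Longrightarrow> dI (dI u) x = u'' x"
proof -
  have dI_u: "dI u x = u' x" if "x \<in> {-1..1}" for x using u that by (simp add: dI_eqI)
  have d2: "(dI u has_real_derivative u'' x) (at x within {-1..1})" if "x \<in> {-1..1}" for x
    by (rule has_field_derivative_transform_within[OF u'[OF that] zero_less_one that]) (simp add: dI_u)
  have "continuous_on {-1..1} u'"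
    using u' by (meson DERIV_continuous_on)
  then have "u \<in> C1_I" using u by (rule C1_I_I[rotated])
  moreover have "dI u \<in> C1_I" using d2 assms(3) by (rule C1_I_I)
  ultimately show "u \<in> C2_I" by (simp add: C2_I_def)
  show "dI (dI u) x = u'' x" if "x \<in> {-1..1}" for x
    using d2[OF that] that by (rule dI_eqI)
qed

lemma constant_on_interval:
  fixes f :: "real \<Rightarrow> real"
  assumes "\<And>x. x \<in> {-1..1} \<Longrightarrow> (f has_real_derivative f' x) (at x within {-1..1})"
    and "\<And>x. x \<in> {-1<..<1} \<Longrightarrow> f' x = 0" and "x \<in> {-1..1}"
  shows "f x = f (-1)"
proof (rule DERIV_isconst2[of "-1" 1])
  show "continuous_on {-1..1} f" using assms(1) by (meson DERIV_continuous_on)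
  fix y :: real assume "-1 < y" "y < 1"
  then show "(f has_real_derivative 0) (at y)"
    using assms(1)[of y] assms(2)[of y] by (simp add: at_within_Icc_at)
qed (use assms(3) in auto)

text \<open>
  Variation of constants: the two coefficients of \<open>u\<close> with respect to \<open>sin (s * x)\<close> and \<open>cos (s * x)\<close>
  have derivative zero.
\<close>

lemma harmonic_solution:
  assumes u: "u \<in> C2_I" and ode: "\<And>x. x \<in> {-1<..<1} \<Longrightarrow> - dI (dI u) x = s\<^sup>2 * u x" and s: "s > 0"
  obtains r \<phi> where "\<And>x. x \<in> {-1..1} \<Longrightarrow> u x = r * sin (s * x + \<phi>)"
proof -
  note d = dI_works[of u] dI_works[of "dI u"]
  have C1: "u \<in> C1_I" "dI u \<in> C1_I" using u by (auto simp: C2_I_def)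
  define P where "P x = u x * sin (s * x) + dI u x / s * cos (s * x)" for x
  define Q where "Q x = u x * cos (s * x) - dI u x / s * sin (s * x)" for x
  have P: "P x = P (-1)" if "x \<in> {-1..1}" for x
  proof (rule constant_on_interval[OF _ _ that])
    fix x :: real assume "x \<in> {-1..1}"
    then show "(P has_real_derivative (u x * s + dI (dI u) x / s) * cos (s * x)) (at x within {-1..1})"
      unfolding P_def[abs_def] using C1 s
      by (auto intro!: derivative_eq_intros d simp: field_simps)
  next
    fix x :: real assume "x \<in> {-1<..<1}"
    with ode[of x] have "dI (dI u) x = - (s\<^sup>2 * u x)" by simp
    then show "(u x * s + dI (dI u) x / s) * cos (s * x) = 0"
      using s by (simp add: power2_eq_square)
  qed
  have Q: "Q x = Q (-1)" if "x \<in> {-1..1}" for x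
  proof (rule constant_on_interval[OF _ _ that])
    fix x :: real assume "x \<in> {-1..1}"
    then show "(Q has_real_derivative - (u x * s + dI (dI u) x / s) * sin (s * x)) (at x within {-1..1})"
      unfolding Q_def[abs_def] using C1 s
      by (auto intro!: derivative_eq_intros d simp: field_simps)
  next
    fix x :: real assume "x \<in> {-1<..<1}"
    with ode[of x] have "dI (dI u) x = - (s\<^sup>2 * u x)" by simp
    then show "- (u x * s + dI (dI u) x / s) * sin (s * x) = 0"
      using s by (simp add: power2_eq_square)
  qed
  obtain r \<phi> where r: "P (-1) = r * cos \<phi>" "Q (-1) = r * sin \<phi>" using polar_Ex by blast
  have "u x = r * sin (s * x + \<phi>)" if "x \<in> {-1..1}" for x
  proof -
    have "P x * sin (s * x) + Q x * cos (s * x) = u x * ((sin (s * x))\<^sup>2 + (cos (s * x))\<^sup>2)"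
      unfolding P_def Q_def by algebra
    then have "u x = P x * sin (s * x) + Q x * cos (s * x)" by simp
    then show ?thesis by (simp add: P[OF that] Q[OF that] r sin_add algebra_simps)
  qed
  then show ?thesis by (rule that)
qed

text \<open>
  Passes from a formula to the representative required of solutions.
\<close>

definition on_interval :: "(real \<Rightarrow> real) \<Rightarrow> real \<Rightarrow> real" where
  "on_interval f x = (if x \<in> {-1..1} then f x else 0)"

lemma on_interval_deriv:
  assumes "(f has_real_derivative d) (at x)" "x \<in> {-1..1}"
  shows "(on_interval f has_real_derivative d) (at x within {-1..1})"
  using has_field_derivative_at_within[OF assms(1)] assms(2)
  by (rule has_field_derivative_transform_within[OF _ zero_less_one]) (auto simp: on_interval_def)

lemma sine_C2:
  fixes s \<phi> r :: real
  defines "u \<equiv> on_interval (\<lambda>x. r * sin (s * x + \<phi>))"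
  shows "u \<in> C2_I"
    and "\<And>x. x \<in> {-1..1} \<Longrightarrow> dI u x = r * s * cos (s * x + \<phi>)"
    and "\<And>x. x \<in> {-1..1} \<Longrightarrow> dI (dI u) x = - s\<^sup>2 * u x"
proof -
  have 1: "(u has_real_derivative r * s * cos (s * x + \<phi>)) (at x within {-1..1})"
    if "x \<in> {-1..1}" for x
    unfolding u_def using that by (intro on_interval_deriv) (auto intro!: derivative_eq_intros)
  have 2: "((\<lambda>x. r * s * cos (s * x + \<phi>)) has_real_derivative - s\<^sup>2 * (r * sin (s * x + \<phi>))) (at x within {-1..1})" for x
    by (auto intro!: derivative_eq_intros simp: power2_eq_square)
  show "dI u x = r * s * cos (s * x + \<phi>)" if "x \<in> {-1..1}" for x
    using 1[OF that] that by (rule dI_eqI)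
  have 3: "continuous_on {-1..1} (\<lambda>x. - s\<^sup>2 * (r * sin (s * x + \<phi>)))"
    by (intro continuous_intros)
  show "u \<in> C2_I" using 1 2 3 by (rule C2_I_I(1))
  show "dI (dI u) x = - s\<^sup>2 * u x" if "x \<in> {-1..1}" for x
    using C2_I_I(2)[OF 1 2 3 that] that by (simp add: u_def on_interval_def)
qed

section \<open>Positive eigenvalues\<close>

locale multi_point =
  fixes m :: "sign \<Rightarrow> nat" and \<alpha> \<beta> \<eta> :: "sign \<Rightarrow> nat \<Rightarrow> real"
  assumes node_range: "\<And>\<nu> i. i \<in> {1..m \<nu>} \<Longrightarrow> \<eta> \<nu> i \<in> {-1..1}"
    and \<alpha>0_nonneg: "\<And>\<nu>. \<alpha> \<nu> 0 \<ge> 0"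
    and nontrivial: "\<And>\<nu>. \<alpha> \<nu> 0 + \<bar>\<beta> \<nu> 0\<bar> > 0"
    and \<beta>0_sign: "\<And>\<nu>. sgnval \<nu> * \<beta> \<nu> 0 \<ge> 0"
    and coeff_cond: "\<And>\<nu>. coeff_cond m \<alpha> \<beta> \<nu>"

lemma sgnval_sq: "sgnval \<nu> * sgnval \<nu> = 1" "\<bar>sgnval \<nu>\<bar> = 1" "sgnval \<nu> \<noteq> 0"
  by (cases \<nu>; simp)+

context multi_point
begin

text \<open>
  The data of the end \<open>\<nu>\<close> in terms of the distance from it and of the inward derivative, which is
  \<open>- sgnval \<nu> * u'\<close>.
\<close>

definition end_coeff :: "sign \<Rightarrow> real" where "end_coeff \<nu> = sgnval \<nu> * \<beta> \<nu> 0"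
definition node_coeff :: "sign \<Rightarrow> nat \<Rightarrow> real" where "node_coeff \<nu> i = - sgnval \<nu> * \<beta> \<nu> i"
definition node_dist :: "sign \<Rightarrow> nat \<Rightarrow> real" where "node_dist \<nu> i = 1 - sgnval \<nu> * \<eta> \<nu> i"

end

sublocale multi_point \<subseteq> ph: boundary_phase "m \<nu>" "\<alpha> \<nu> 0" "end_coeff \<nu>" "\<alpha> \<nu>" "node_coeff \<nu>" "node_dist \<nu>" for \<nu>
proof
  have abs_eq: "\<bar>node_coeff \<nu> i\<bar> = \<bar>\<beta> \<nu> i\<bar>" for i by (simp add: node_coeff_def abs_mult sgnval_sq)
  have sq_eq: "(x / end_coeff \<nu>)\<^sup>2 = (x / \<beta> \<nu> 0)\<^sup>2" for x
    by (simp add: end_coeff_def power_divide power_mult_distrib) (simp add: sgnval_sq power2_eq_square)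
  show "0 \<le> \<alpha> \<nu> 0" by (rule \<alpha>0_nonneg)
  show "0 \<le> end_coeff \<nu>" unfolding end_coeff_def by (rule \<beta>0_sign)
  show "0 < \<alpha> \<nu> 0 + end_coeff \<nu>"
    using nontrivial[of \<nu>] \<beta>0_sign[of \<nu>] unfolding end_coeff_def
    by (metis abs_mult abs_of_nonneg mult_1 sgnval_sq(2))
  show "node_dist \<nu> i \<in> {0..2}" if "i \<in> {1..m \<nu>}" for i
    unfolding node_dist_def using node_range[OF that] by (cases \<nu>) auto
  show "\<alpha> \<nu> 0 = 0 \<Longrightarrow> (\<Sum>i = 1..m \<nu>. \<bar>\<alpha> \<nu> i\<bar>) = 0"
    using coeff_cond[of \<nu>] by (simp add: coeff_cond_def)
  show "end_coeff \<nu> = 0 \<Longrightarrow> (\<Sum>i = 1..m \<nu>. \<bar>node_coeff \<nu> i\<bar>) = 0"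
    using coeff_cond[of \<nu>] unfolding abs_eq by (simp add: coeff_cond_def sgnval_sq end_coeff_def)
  show "((\<Sum>i = 1..m \<nu>. \<bar>\<alpha> \<nu> i\<bar>) / \<alpha> \<nu> 0)\<^sup>2 + ((\<Sum>i = 1..m \<nu>. \<bar>node_coeff \<nu> i\<bar>) / end_coeff \<nu>)\<^sup>2 < 1"
    using coeff_cond[of \<nu>] unfolding abs_eq sq_eq by (simp add: coeff_cond_def)
qed

context multi_point
begin

text \<open>
  In terms of the distance \<open>t\<close> from the end \<open>\<nu>\<close>, \<open>sin (s * x + \<phi>)\<close> is \<open>sin (s * t + (\<phi> - s))\<close> at the left
  end and \<open>- sin (s * t + (- \<phi> - s))\<close> at the right end, which explains the phase in the conclusion.
\<close>

lemma boundary_cond_sine: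
  assumes s: "0 < s"
    and u: "\<And>x. x \<in> {-1..1} \<Longrightarrow> u x = r * sin (s * x + \<phi>)"
    and u': "\<And>x. x \<in> {-1..1} \<Longrightarrow> dI u x = r * s * cos (s * x + \<phi>)"
  shows "boundary_cond m \<alpha> \<beta> \<eta> \<nu> u \<longleftrightarrow> r = 0 \<or> ph.bc \<nu> s (- sgnval \<nu> * \<phi> - s) = 0"
proof -
  define K where "K = \<alpha> \<nu> 0 * sin (s * sgnval \<nu> + \<phi>) + s * \<beta> \<nu> 0 * cos (s * sgnval \<nu> + \<phi>)
    - (\<Sum>i=1..m \<nu>. \<alpha> \<nu> i * sin (s * \<eta> \<nu> i + \<phi>) + s * \<beta> \<nu> i * cos (s * \<eta> \<nu> i + \<phi>))"
  have end_in: "sgnval \<nu> \<in> {-1..1}" by (cases \<nu>) auto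
  have 1: "(\<Sum>i=1..m \<nu>. \<alpha> \<nu> i * u (\<eta> \<nu> i)) + (\<Sum>i=1..m \<nu>. \<beta> \<nu> i * dI u (\<eta> \<nu> i))
    = r * (\<Sum>i=1..m \<nu>. \<alpha> \<nu> i * sin (s * \<eta> \<nu> i + \<phi>) + s * \<beta> \<nu> i * cos (s * \<eta> \<nu> i + \<phi>))"
    unfolding sum.distrib[symmetric] sum_distrib_left
  proof (rule sum.cong[OF refl])
    fix i assume "i \<in> {1..m \<nu>}"
    from node_range[OF this] show "\<alpha> \<nu> i * u (\<eta> \<nu> i) + \<beta> \<nu> i * dI u (\<eta> \<nu> i)
      = r * (\<alpha> \<nu> i * sin (s * \<eta> \<nu> i + \<phi>) + s * \<beta> \<nu> i * cos (s * \<eta> \<nu> i + \<phi>))"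
      by (simp only: u u') (simp add: algebra_simps)
  qed
  have "boundary_cond m \<alpha> \<beta> \<eta> \<nu> u \<longleftrightarrow> r * K = 0"
    unfolding boundary_cond_def 1 u[OF end_in] u'[OF end_in] K_def
    by (simp add: algebra_simps)
  moreover have "K = 0 \<longleftrightarrow> ph.bc \<nu> s (- sgnval \<nu> * \<phi> - s) = 0"
  proof -
    have trig: "sin (- sgnval \<nu> * \<phi> - s + s * (1 - sgnval \<nu> * t)) = - sgnval \<nu> * sin (s * t + \<phi>)"
      "cos (- sgnval \<nu> * \<phi> - s + s * (1 - sgnval \<nu> * t)) = cos (s * t + \<phi>)" for t
    proof -
      have "- sgnval \<nu> * \<phi> - s + s * (1 - sgnval \<nu> * t) = - (sgnval \<nu> * (s * t + \<phi>))"
        by (simp add: algebra_simps)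
      moreover have "sin (- (sgnval \<nu> * y)) = - sgnval \<nu> * sin y" "cos (- (sgnval \<nu> * y)) = cos y" for y
        by (cases \<nu>; simp)+
      ultimately show "sin (- sgnval \<nu> * \<phi> - s + s * (1 - sgnval \<nu> * t)) = - sgnval \<nu> * sin (s * t + \<phi>)"
        "cos (- sgnval \<nu> * \<phi> - s + s * (1 - sgnval \<nu> * t)) = cos (s * t + \<phi>)"
        by simp_all
    qed
    have trig0: "sin (- sgnval \<nu> * \<phi> - s) = - sgnval \<nu> * sin (s * sgnval \<nu> + \<phi>)"
      "cos (- sgnval \<nu> * \<phi> - s) = cos (s * sgnval \<nu> + \<phi>)"
      using trig[of "sgnval \<nu>"] by (simp_all add: sgnval_sq)
    have sq: "sgnval \<nu> * (sgnval \<nu> * x) = x" for x by (simp add: sgnval_sq flip: mult.assoc)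
    show ?thesis
    proof (cases "\<alpha> \<nu> 0 = 0")
      case False
      then have sc: "ph.scale \<nu> s = s" by (simp add: ph.scale_def)
      have "ph.im_part \<nu> s (- sgnval \<nu> * \<phi> - s) i
        = - sgnval \<nu> * (\<alpha> \<nu> i * sin (s * \<eta> \<nu> i + \<phi>) + s * \<beta> \<nu> i * cos (s * \<eta> \<nu> i + \<phi>))" for i
        unfolding ph.im_part_def sc node_dist_def node_coeff_def trig by (simp add: algebra_simps)
      then have "(\<Sum>i=1..m \<nu>. ph.im_part \<nu> s (- sgnval \<nu> * \<phi> - s) i)
        = - sgnval \<nu> * (\<Sum>i=1..m \<nu>. \<alpha> \<nu> i * sin (s * \<eta> \<nu> i + \<phi>) + s * \<beta> \<nu> i * cos (s * \<eta> \<nu> i + \<phi>))"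
        unfolding sum_distrib_left by (intro sum.cong) auto
      then have "ph.bc \<nu> s (- sgnval \<nu> * \<phi> - s) = - sgnval \<nu> * K"
        unfolding ph.bc_def unfolding sc K_def end_coeff_def trig0 by (simp add: algebra_simps)
      then show ?thesis by (simp add: sgnval_sq)
    next
      case True
      then have sc: "ph.scale \<nu> s = 1" unfolding ph.scale_def by simp
      \<comment> \<open>Only derivative terms remain, and \<open>bc\<close> is the defect divided by \<open>s\<close>.\<close>
      have a: "\<alpha> \<nu> i = 0" if "i \<in> {1..m \<nu>}" for i
        using ph.a_degenerate[OF True] that by (simp add: sum_nonneg_eq_0_iff)
      have "s * ph.im_part \<nu> s (- sgnval \<nu> * \<phi> - s) i
        = - sgnval \<nu> * (\<alpha> \<nu> i * sin (s * \<eta> \<nu> i + \<phi>) + s * \<beta> \<nu> i * cos (s * \<eta> \<nu> i + \<phi>))"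
        if "i \<in> {1..m \<nu>}" for i
        unfolding ph.im_part_def sc node_dist_def node_coeff_def trig using a[OF that] by (simp add: algebra_simps)
      then have "s * (\<Sum>i=1..m \<nu>. ph.im_part \<nu> s (- sgnval \<nu> * \<phi> - s) i)
        = - sgnval \<nu> * (\<Sum>i=1..m \<nu>. \<alpha> \<nu> i * sin (s * \<eta> \<nu> i + \<phi>) + s * \<beta> \<nu> i * cos (s * \<eta> \<nu> i + \<phi>))"
        unfolding sum_distrib_left by (intro sum.cong) auto
      then have "s * ph.bc \<nu> s (- sgnval \<nu> * \<phi> - s) = - sgnval \<nu> * K"
        unfolding ph.bc_def unfolding sc K_def end_coeff_def trig0 right_diff_distrib[of s] using True
        by (simp add: algebra_simps)
      moreover have "s * ph.bc \<nu> s (- sgnval \<nu> * \<phi> - s) = 0 \<longleftrightarrow> ph.bc \<nu> s (- sgnval \<nu> * \<phi> - s) = 0"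
        using s by simp
      ultimately show ?thesis by (simp add: sgnval_sq)
    qed
  qed
  ultimately show ?thesis by simp
qed

text \<open>
  The left end asks for \<open>\<phi> = s + phase Minus s\<close> and the right end for \<open>- \<phi> = s + phase Plus s\<close>, both
  modulo \<open>\<pi>\<close>; the sum of the right-hand sides measures the disagreement.  The shift by \<open>\<pi>\<close> makes
  \<open>gap = k * \<pi>\<close> correspond to the \<open>k\<close>-th Pruefer class.
\<close>

definition gap :: "real \<Rightarrow> real" where
  "gap s = 2 * s + ph.phase Minus s + ph.phase Plus s - pi"

text \<open>
  For \<open>s > 0\<close> the solution, unique up to a factor, that satisfies the condition at the left end.
\<close>

definition wave :: "real \<Rightarrow> real \<Rightarrow> real" where
  "wave s = on_interval (\<lambda>x. sin (s * x + (s + ph.phase Minus s)))"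

lemma all_sign: "(\<forall>\<nu>. P \<nu>) \<longleftrightarrow> P Minus \<and> P Plus"
  by (metis sign.exhaust)

text \<open>
  The condition at the left end holds by the choice of the wave.  The value of \<open>gap s\<close> says that the
  phase at the right end is the one selected there.
\<close>

lemma scaled_wave_solution:
  assumes "0 < s" "gap s = of_int k * pi"
  shows "(\<lambda>x. r * wave s x) \<in> solutions m \<alpha> \<beta> \<eta> (s\<^sup>2)"
proof -
  define \<phi> where "\<phi> = s + ph.phase Minus s"
  define u where "u = on_interval (\<lambda>x. r * sin (s * x + \<phi>))"
  have u_eq: "(\<lambda>x. r * wave s x) = u"
    by (auto simp: wave_def u_def \<phi>_def on_interval_def)
  have sine: "u \<in> C2_I" "\<And>x. x \<in> {-1..1} \<Longrightarrow> dI u x = r * s * cos (s * x + \<phi>)"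
    "\<And>x. x \<in> {-1..1} \<Longrightarrow> dI (dI u) x = - s\<^sup>2 * u x"
    unfolding u_def by (fact sine_C2)+
  have u: "u x = r * sin (s * x + \<phi>)" if "x \<in> {-1..1}" for x
    using that by (simp add: u_def on_interval_def)
  have "ph.bc Minus s (\<phi> - s) = 0"
    using assms(1) by (simp add: \<phi>_def ph.bc_phase)
  moreover have "ph.bc Plus s (- \<phi> - s) = 0"
  proof -
    have "- \<phi> - s = ph.phase Plus s + of_int (- k - 1) * pi"
      using assms(2) by (simp add: gap_def \<phi>_def algebra_simps)
    then show ?thesis using assms(1) ph.bc_zero_iff[of s Plus "- \<phi> - s"] by (metis less_imp_le)
  qed
  ultimately have "ph.bc \<nu> s (- sgnval \<nu> * \<phi> - s) = 0" for \<nu>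
    by (cases \<nu>) auto
  then have "boundary_cond m \<alpha> \<beta> \<eta> \<nu> u" for \<nu>
    using boundary_cond_sine[OF assms(1) u sine(2)] by blast
  moreover have "\<forall>x. x \<notin> {-1..1} \<longrightarrow> u x = 0" by (simp add: u_def on_interval_def)
  moreover have "\<forall>x\<in>{-1<..<1}. - dI (dI u) x = s\<^sup>2 * u x" using sine(3) by auto
  ultimately show ?thesis using sine(1) by (simp add: u_eq solutions_def)
qed

text \<open>
  The phase of an eigenfunction must agree modulo \<open>\<pi>\<close> with the phases selected at both ends.
  Adding the two congruences gives the value of \<open>gap\<close>, while the left one alone determines the
  eigenfunction up to a factor.
\<close>

lemma solution_is_scaled_wave:
  assumes s: "0 < s" and u: "u \<in> eigenfunctions m \<alpha> \<beta> \<eta> (s\<^sup>2)"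
  shows "(\<exists>k::int. gap s = of_int k * pi) \<and> (\<exists>c. u = (\<lambda>x. c * wave s x))"
proof -
  have C2: "u \<in> C2_I" and ode: "\<And>x. x \<in> {-1<..<1} \<Longrightarrow> - dI (dI u) x = s\<^sup>2 * u x"
    and bc: "\<And>\<nu>. boundary_cond m \<alpha> \<beta> \<eta> \<nu> u" and out: "\<And>x. x \<notin> {-1..1} \<Longrightarrow> u x = 0"
    and nz: "\<exists>x\<in>{-1..1}. u x \<noteq> 0"
    using u by (auto simp: eigenfunctions_def solutions_def)
  obtain r \<phi> where r: "\<And>x. x \<in> {-1..1} \<Longrightarrow> u x = r * sin (s * x + \<phi>)"
    using harmonic_solution[OF C2 ode s] by blast
  have u_eq: "u = on_interval (\<lambda>x. r * sin (s * x + \<phi>))"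
    using r out by (auto simp: on_interval_def)
  have "r \<noteq> 0" using nz r by auto
  then have zero: "ph.bc \<nu> s (- sgnval \<nu> * \<phi> - s) = 0" for \<nu>
    using boundary_cond_sine[OF s r] sine_C2(2)[of _ r s \<phi>] bc[of \<nu>] unfolding u_eq[symmetric] by blast
  obtain j :: int where j: "\<phi> - s = ph.phase Minus s + of_int j * pi"
    using zero[of Minus] ph.bc_zero_iff[of s Minus] s by auto
  obtain j' :: int where j': "- \<phi> - s = ph.phase Plus s + of_int j' * pi"
    using zero[of Plus] ph.bc_zero_iff[of s Plus] s by auto
  have "gap s = of_int (- j - j' - 1) * pi"
    using j j' by (simp add: gap_def algebra_simps)
  moreover have "u = (\<lambda>x. (r * cos (of_int j * pi)) * wave s x)"
  proof
    fix x
    have arg: "s * x + \<phi> = (s * x + (s + ph.phase Minus s)) + of_int j * pi" using j by simp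
    have "sin (s * x + \<phi>) = sin (s * x + (s + ph.phase Minus s)) * cos (of_int j * pi)"
      unfolding arg sin_add[of _ "of_int j * pi"] by (simp add: sin_zero_iff_int2)
    then show "u x = (r * cos (of_int j * pi)) * wave s x"
      by (simp add: u_eq wave_def on_interval_def)
  qed
  ultimately show ?thesis by blast
qed

lemma wave_nonzero:
  assumes "0 < s"
  shows "\<exists>x\<in>{-1..1}. wave s x \<noteq> 0"
proof (rule ccontr)
  assume "\<not> ?thesis"
  then have z: "\<And>x. x \<in> {-1..1} \<Longrightarrow> wave s x = 0" by blast
  have "(wave s has_real_derivative 0) (at 0 within {-1..1})"
    by (rule has_field_derivative_transform_within[OF DERIV_const[of 0] zero_less_one]) (auto simp: z)
  then have "dI (wave s) 0 = 0" by (rule dI_eqI) simp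
  moreover have "dI (wave s) 0 = s * cos (s + ph.phase Minus s)"
    using sine_C2(2)[of 0 1 s "s + ph.phase Minus s"] by (simp add: wave_def)
  moreover have "wave s 0 = sin (s + ph.phase Minus s)" by (simp add: wave_def on_interval_def)
  ultimately show False
    using z[of 0] assms sin_zero_norm_cos_one by fastforce
qed

lemma wave_eigenfunction:
  assumes "0 < s" "gap s = of_int k * pi"
  shows "wave s \<in> eigenfunctions m \<alpha> \<beta> \<eta> (s\<^sup>2)"
  using scaled_wave_solution[OF assms, of 1] wave_nonzero[OF assms(1)] by (simp add: eigenfunctions_def)

text \<open>
  Both phases have derivative greater than \<open>-1\<close>, which the term \<open>2 * s\<close> outweighs.
\<close>

lemma gap_monotone:
  assumes "0 \<le> s" "s < t"
  shows "gap s < gap t"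
proof (rule DERIV_pos_imp_increasing_open[OF assms(2)])
  have diff: "\<exists>d. (gap has_real_derivative 2 + d) (at x) \<and> (0 < x \<longrightarrow> -2 < d)" if x: "0 \<le> x" for x
  proof -
    obtain d e where d: "(ph.phase Minus has_real_derivative d) (at x)" "(ph.phase Plus has_real_derivative e) (at x)"
      using ph.phase_differentiable[OF x, of Minus] ph.phase_differentiable[OF x, of Plus] by blast
    have "(gap has_real_derivative 2 + (d + e)) (at x)"
      unfolding gap_def[abs_def] by (auto intro!: derivative_eq_intros d)
    moreover have "-2 < d + e" if "0 < x"
      using ph.phase_derivative_gt[OF that d(1)] ph.phase_derivative_gt[OF that d(2)] by linarith
    ultimately show ?thesis by blast
  qed
  show "\<exists>y. (gap has_real_derivative y) (at x) \<and> y > 0" if "s < x" "x < t" for x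
    using diff[of x] that assms by force
  show "continuous_on {s..t} gap"
    using diff assms by (intro continuous_at_imp_continuous_on ballI)
      (metis DERIV_isCont atLeastAtMost_iff order_trans)
qed

lemma gap_continuous: "continuous_on {0..t} gap"
proof -
  have "isCont (ph.phase \<nu>) x" if "0 \<le> x" for x \<nu>
    using ph.phase_differentiable[OF that] DERIV_isCont by blast
  then show ?thesis
    unfolding gap_def[abs_def]
    by (intro continuous_intros continuous_at_imp_continuous_on) auto
qed

lemma phase_bounds:
  assumes "0 \<le> s"
  shows "- (pi / 2) < ph.phase \<nu> s" "ph.phase \<nu> s < pi"
  using ph.phase_near_base[of \<nu> s] ph.base_range[OF assms, of \<nu>] unfolding abs_less_iff by linarith+

lemma gap_bounds:
  assumes "0 \<le> s"
  shows "2 * s - 2 * pi \<le> gap s" "gap s \<le> 2 * s + pi"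
  using phase_bounds[OF assms, of Minus] phase_bounds[OF assms, of Plus] unfolding gap_def by linarith+

lemma gap_0: "gap 0 = (if \<alpha> Minus 0 = 0 then pi / 2 else 0) + (if \<alpha> Plus 0 = 0 then pi / 2 else 0) - pi"
  by (simp only: gap_def ph.phase_0 mult_zero_right add_0)

text \<open>
  The value is unique by \<open>gap_inj\<close>; the square of \<open>crossing k\<close> will be the \<open>k\<close>-th eigenvalue.
\<close>

definition crossing :: "nat \<Rightarrow> real" where
  "crossing k = (SOME s. 0 \<le> s \<and> gap s = real k * pi)"

lemma crossing: "0 \<le> crossing k" "gap (crossing k) = real k * pi"
proof -
  \<comment> \<open>Chosen such that the lower bound \<open>2 * T - 2 * \<pi>\<close> for \<open>gap T\<close> equals \<open>k * \<pi>\<close>.\<close>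
  define T where "T = (real k + 2) * pi / 2"
  have T: "0 \<le> T" by (simp add: T_def)
  have "gap 0 \<le> 0" by (simp add: gap_0)
  also have "0 \<le> real k * pi" by simp
  finally have "gap 0 \<le> real k * pi" .
  moreover have "real k * pi \<le> gap T"
    using gap_bounds(1)[OF T] by (simp add: T_def algebra_simps)
  ultimately have "\<exists>s\<ge>0. s \<le> T \<and> gap s = real k * pi"
    using IVT'[OF _ _ T gap_continuous] by blast
  then have "\<exists>s. 0 \<le> s \<and> gap s = real k * pi" by blast
  from someI_ex[OF this] show "0 \<le> crossing k" "gap (crossing k) = real k * pi"
    unfolding crossing_def by auto
qed

lemma gap_inj: "0 \<le> s \<Longrightarrow> 0 \<le> t \<Longrightarrow> gap s = gap t \<Longrightarrow> s = t"
  using gap_monotone[of s t] gap_monotone[of t s] by linarith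

lemma crossing_strict_mono: "strict_mono crossing"
proof (rule strict_monoI)
  fix k l :: nat assume "k < l"
  then have "gap (crossing k) < gap (crossing l)" by (simp add: crossing)
  then show "crossing k < crossing l"
    using gap_monotone[of "crossing l" "crossing k"] crossing(1)[of l] by (cases "crossing k = crossing l") force+
qed

text \<open>
  The angle of the wave is \<open>s * (x + 1) + phase Minus s\<close>.  At \<open>-1\<close> it is \<open>phase Minus s\<close>, and at \<open>1\<close> it is
  \<open>\<pi> - phase Plus s + k * \<pi>\<close>; the two angles of comparison are \<open>base Minus s\<close> and \<open>\<pi> - base Plus s\<close>.
\<close>

lemma wave_in_P_plus:
  assumes s: "0 < s" and k: "gap s = real k * pi"
  shows "(s\<^sup>2, wave s) \<in> P_plus \<alpha> \<beta> k"
proof -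
  define \<omega> where "\<omega> x = s * x + (s + ph.phase Minus s)" for x
  have w: "wave s x = sin (\<omega> x)" if "x \<in> {-1..1}" for x
    using that by (simp add: wave_def on_interval_def \<omega>_def)
  have w': "dI (wave s) x = s * cos (\<omega> x)" if "x \<in> {-1..1}" for x
    using sine_C2(2)[of x 1 s "s + ph.phase Minus s"] that by (simp add: wave_def \<omega>_def)
  have "wave s \<in> C2_I" using sine_C2(1)[of 1 s "s + ph.phase Minus s"] by (simp add: wave_def)
  then have "wave s \<in> C1_I" by (simp add: C2_I_def)
  moreover have "\<bar>wave s x\<bar> + \<bar>dI (wave s) x\<bar> > 0" if "x \<in> {-1..1}" for x
  proof -
    have "sin (\<omega> x) \<noteq> 0 \<or> cos (\<omega> x) \<noteq> 0" using sin_zero_norm_cos_one[of "\<omega> x"] by force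
    then show ?thesis using s w[OF that] w'[OF that] by (auto simp: add_nonneg_pos add_pos_nonneg)
  qed
  ultimately have simple: "wave s \<in> C1_simple" by (simp add: C1_simple_def)
  have "continuous_on {-1..1} \<omega>" unfolding \<omega>_def by (intro continuous_intros)
  then have prufer: "prufer_angle (s\<^sup>2) (wave s) \<omega>"
    using s w w' by (auto simp: prufer_angle_def tan_def)
  have "angle0 \<alpha> \<beta> (s\<^sup>2) Minus = ph.base Minus s"
    unfolding ph.base_def unfolding end_coeff_def using s by (simp add: angle0_def arctan_minus)
  then have "\<bar>\<omega> (-1) - angle0 \<alpha> \<beta> (s\<^sup>2) Minus\<bar> < pi / 2"
    using ph.phase_near_base[of Minus s] by (simp add: \<omega>_def)
  moreover have "angle0 \<alpha> \<beta> (s\<^sup>2) Plus = pi - ph.base Plus s"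
    unfolding ph.base_def unfolding end_coeff_def using s by (simp add: angle0_def)
  then have "\<bar>\<omega> 1 - angle0 \<alpha> \<beta> (s\<^sup>2) Plus - real k * pi\<bar> < pi / 2"
  proof -
    assume "angle0 \<alpha> \<beta> (s\<^sup>2) Plus = pi - ph.base Plus s"
    then have "\<omega> 1 - angle0 \<alpha> \<beta> (s\<^sup>2) Plus - real k * pi = ph.base Plus s - ph.phase Plus s"
      using k by (simp add: \<omega>_def gap_def)
    then show ?thesis using ph.phase_near_base[of Plus s] by (simp add: abs_minus_commute)
  qed
  ultimately show ?thesis
    using s simple prufer by (auto simp: P_plus_def)
qed

lemma geom_mult_1I:
  assumes "solutions m \<alpha> \<beta> \<eta> lam = range (\<lambda>c x. c * w x)" and "\<exists>x. w x \<noteq> 0"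
  shows "geom_mult m \<alpha> \<beta> \<eta> lam = 1"
proof -
  have "solutions m \<alpha> \<beta> \<eta> lam = fun_vs.span {w}"
    by (simp add: assms(1) fun_vs.span_singleton)
  moreover have "fun_vs.independent {w}"
    using assms(2) by (auto simp: fun_vs.dependent_single func_zero)
  ultimately show ?thesis
    by (simp add: geom_mult_def fun_vs.dim_span fun_vs.dim_eq_card_independent)
qed

end

section \<open>Nonpositive eigenvalues\<close>

lemma derivative_sign_at_maximum:
  assumes d: "(g has_real_derivative d) (at x0 within {-1..1})"
    and max: "\<And>x. x \<in> {-1..1} \<Longrightarrow> g x \<le> g x0" and x0: "x0 \<in> {-1..1}"
  shows "x0 < 1 \<Longrightarrow> d \<le> 0" and "-1 < x0 \<Longrightarrow> 0 \<le> d"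
proof -
  show "d \<le> 0" if "x0 < 1"
  proof (rule ccontr)
    assume "\<not> d \<le> 0"
    with has_real_derivative_pos_inc_right[OF d] obtain e where e: "e > 0"
      "\<And>h. h > 0 \<Longrightarrow> x0 + h \<in> {-1..1} \<Longrightarrow> h < e \<Longrightarrow> g x0 < g (x0 + h)" by auto
    define h where "h = min (e / 2) (1 - x0)"
    have "h > 0" "x0 + h \<in> {-1..1}" "h < e" using e(1) that x0 by (auto simp: h_def)
    with e(2) max show False by force
  qed
  show "0 \<le> d" if "-1 < x0"
  proof (rule ccontr)
    assume "\<not> 0 \<le> d"
    with has_real_derivative_neg_dec_left[OF d] obtain e where e: "e > 0"
      "\<And>h. h > 0 \<Longrightarrow> x0 - h \<in> {-1..1} \<Longrightarrow> h < e \<Longrightarrow> g x0 < g (x0 - h)" by auto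
    define h where "h = min (e / 2) (x0 + 1)"
    have "h > 0" "x0 - h \<in> {-1..1}" "h < e" using e(1) that x0 by (auto simp: h_def)
    with e(2) max show False by force
  qed
qed

text \<open>
  The energy \<open>u'\<^sup>2 + lam * u\<^sup>2\<close> is constant and \<open>lam \<le> 0\<close>, so \<open>\<bar>u'\<bar>\<close> is largest wherever \<open>\<bar>u\<bar>\<close> is.  If
  this happens in the interior, \<open>u'\<close> vanishes there and hence everywhere, so that \<open>u\<close> is constant and
  either end point will do.
\<close>

lemma nonpositive_endpoint_max:
  assumes u: "u \<in> C2_I" and ode: "\<And>x. x \<in> {-1<..<1} \<Longrightarrow> - dI (dI u) x = lam * u x" and lam: "lam \<le> 0"
  obtains \<nu> where "\<And>x. x \<in> {-1..1} \<Longrightarrow> \<bar>u x\<bar> \<le> \<bar>u (sgnval \<nu>)\<bar>"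
    "\<And>x. x \<in> {-1..1} \<Longrightarrow> \<bar>dI u x\<bar> \<le> \<bar>dI u (sgnval \<nu>)\<bar>"
    "0 \<le> sgnval \<nu> * (u (sgnval \<nu>) * dI u (sgnval \<nu>))"
proof -
  note result = that
  have C1: "u \<in> C1_I" "dI u \<in> C1_I" using u by (auto simp: C2_I_def)
  note d = dI_works[OF C1(1)] dI_works[OF C1(2)]
  define E where "E x = (dI u x)\<^sup>2 + lam * (u x)\<^sup>2" for x
  have E: "E x = E (-1)" if "x \<in> {-1..1}" for x
  proof (rule constant_on_interval[OF _ _ that])
    fix x :: real assume "x \<in> {-1..1}"
    then show "(E has_real_derivative 2 * dI u x * (dI (dI u) x + lam * u x)) (at x within {-1..1})"
      unfolding E_def[abs_def]
      by (auto intro!: derivative_eq_intros d simp: algebra_simps)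
  next
    fix x :: real assume "x \<in> {-1<..<1}"
    from ode[OF this] show "2 * dI u x * (dI (dI u) x + lam * u x) = 0" by simp
  qed
  have du2: "((\<lambda>x. (u x)\<^sup>2) has_real_derivative 2 * (u x * dI u x)) (at x within {-1..1})"
    if "x \<in> {-1..1}" for x
    using that by (auto intro!: derivative_eq_intros d)
  have "continuous_on {-1..1} (\<lambda>x. (u x)\<^sup>2)" using du2 by (rule DERIV_continuous_on)
  then obtain x0 where x0: "x0 \<in> {-1..1}" and max: "\<And>x. x \<in> {-1..1} \<Longrightarrow> (u x)\<^sup>2 \<le> (u x0)\<^sup>2"
    using continuous_attains_sup[of "{-1..1::real}" "\<lambda>x. (u x)\<^sup>2"] by auto
  note sign = derivative_sign_at_maximum[OF du2[OF x0] max x0]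
  have max': "(dI u x)\<^sup>2 \<le> (dI u x0)\<^sup>2" if "x \<in> {-1..1}" for x
  proof -
    have "(dI u x)\<^sup>2 + lam * (u x)\<^sup>2 = (dI u x0)\<^sup>2 + lam * (u x0)\<^sup>2"
      using E[OF that] E[OF x0] by (simp add: E_def)
    moreover have "lam * (u x0)\<^sup>2 \<le> lam * (u x)\<^sup>2"
      using max[OF that] lam by (rule mult_left_mono_neg)
    ultimately show ?thesis by linarith
  qed
  have at_end: thesis if "x0 = sgnval \<nu>" for \<nu>
  proof (rule result)
    show "\<bar>u x\<bar> \<le> \<bar>u (sgnval \<nu>)\<bar>" "\<bar>dI u x\<bar> \<le> \<bar>dI u (sgnval \<nu>)\<bar>" if "x \<in> {-1..1}" for x
      using max[OF that] max'[OF that] \<open>x0 = sgnval \<nu>\<close> by (simp_all add: abs_le_square_iff)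
    show "0 \<le> sgnval \<nu> * (u (sgnval \<nu>) * dI u (sgnval \<nu>))"
      using sign \<open>x0 = sgnval \<nu>\<close> by (cases \<nu>) auto
  qed
  show thesis
  proof (cases "x0 = -1 \<or> x0 = 1")
    case True
    then show thesis using at_end[of Minus] at_end[of Plus] by auto
  next
    case False
    with x0 sign have "u x0 * dI u x0 = 0" by force
    moreover have "u x0 = 0 \<Longrightarrow> dI u x0 = 0"
    proof -
      assume "u x0 = 0"
      then have z: "u x = 0" if "x \<in> {-1..1}" for x using max[OF that] by simp
      have "(u has_real_derivative 0) (at x0 within {-1..1})"
        by (rule has_field_derivative_transform_within[OF DERIV_const[of 0] zero_less_one x0]) (simp add: z)
      then show ?thesis using x0 by (rule dI_eqI)
    qed
    ultimately have flat: "dI u x = 0" if "x \<in> {-1..1}" for x using max'[OF that] by auto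
    have const: "u x = u (-1)" if "x \<in> {-1..1}" for x
      by (rule constant_on_interval[OF d(1) _ that]) (simp_all add: flat)
    show thesis
    proof (rule result[of Plus])
      show "\<bar>u x\<bar> \<le> \<bar>u (sgnval Plus)\<bar>" if "x \<in> {-1..1}" for x
        unfolding const[OF that] using const[of 1] by simp
    qed (simp_all add: flat)
  qed
qed

context multi_point
begin

text \<open>
  At the end point \<open>\<nu>\<close> where \<open>\<bar>u\<bar>\<close> and \<open>\<bar>u'\<bar>\<close> have their maxima \<open>U\<close> and \<open>V\<close>, the two terms of the local
  part have the same sign, so the condition gives
  \<open>\<alpha>\<^sub>0 * U + \<bar>\<beta>\<^sub>0\<bar> * V \<le> \<Sum>\<bar>\<alpha>\<^sub>i\<bar> * U + \<Sum>\<bar>\<beta>\<^sub>i\<bar> * V\<close>.  Each sum is smaller than its counterpart unless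
  both vanish; as \<open>U > 0\<close>, this forces \<open>\<alpha>\<^sub>0 = 0\<close>, then \<open>\<beta>\<^sub>0 \<noteq> 0\<close> and so \<open>V = 0\<close>.  Thus \<open>u\<close> is
  constant, and for a constant the condition at the other end requires \<open>\<alpha>\<^sub>0 = 0\<close> there too.
\<close>

lemma nonpositive_eigenfunction:
  assumes u: "u \<in> eigenfunctions m \<alpha> \<beta> \<eta> lam" and lam: "lam \<le> 0"
  shows "lam = 0 \<and> (\<forall>\<nu>. \<alpha> \<nu> 0 = 0) \<and> (\<exists>c. u = on_interval (\<lambda>_. c))"
proof -
  have C2: "u \<in> C2_I" and ode: "\<And>x. x \<in> {-1<..<1} \<Longrightarrow> - dI (dI u) x = lam * u x"
    and bc: "\<And>\<nu>. boundary_cond m \<alpha> \<beta> \<eta> \<nu> u" and out: "\<And>x. x \<notin> {-1..1} \<Longrightarrow> u x = 0"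
    and nz: "\<exists>x\<in>{-1..1}. u x \<noteq> 0"
    using u by (auto simp: eigenfunctions_def solutions_def)
  obtain \<nu> where max: "\<And>x. x \<in> {-1..1} \<Longrightarrow> \<bar>u x\<bar> \<le> \<bar>u (sgnval \<nu>)\<bar>"
    and max': "\<And>x. x \<in> {-1..1} \<Longrightarrow> \<bar>dI u x\<bar> \<le> \<bar>dI u (sgnval \<nu>)\<bar>"
    and sign: "0 \<le> sgnval \<nu> * (u (sgnval \<nu>) * dI u (sgnval \<nu>))"
    using nonpositive_endpoint_max[OF C2 ode lam] by blast
  have node_coeff_abs: "\<bar>node_coeff \<nu> i\<bar> = \<bar>\<beta> \<nu> i\<bar>" for \<nu> i by (simp add: node_coeff_def abs_mult sgnval_sq)
  have bound: "\<bar>\<alpha> \<nu> 0 * u (sgnval \<nu>) + \<beta> \<nu> 0 * dI u (sgnval \<nu>)\<bar>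
     \<le> (\<Sum>i=1..m \<nu>. \<bar>\<alpha> \<nu> i\<bar>) * U + (\<Sum>i=1..m \<nu>. \<bar>node_coeff \<nu> i\<bar>) * V"
    if U: "\<And>x. x \<in> {-1..1} \<Longrightarrow> \<bar>u x\<bar> \<le> U" and V: "\<And>x. x \<in> {-1..1} \<Longrightarrow> \<bar>dI u x\<bar> \<le> V" for \<nu> U V
  proof -
    have "\<bar>\<Sum>i=1..m \<nu>. \<alpha> \<nu> i * u (\<eta> \<nu> i)\<bar> \<le> (\<Sum>i=1..m \<nu>. \<bar>\<alpha> \<nu> i\<bar> * U)"
      by (rule order_trans[OF sum_abs], rule sum_mono)
        (use U node_range in \<open>auto simp: abs_mult intro!: mult_left_mono\<close>)
    moreover have "\<bar>\<Sum>i=1..m \<nu>. \<beta> \<nu> i * dI u (\<eta> \<nu> i)\<bar> \<le> (\<Sum>i=1..m \<nu>. \<bar>node_coeff \<nu> i\<bar> * V)"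
      unfolding node_coeff_abs
      by (rule order_trans[OF sum_abs], rule sum_mono)
        (use V node_range in \<open>auto simp: abs_mult intro!: mult_left_mono\<close>)
    ultimately show ?thesis
      using bc[of \<nu>] unfolding boundary_cond_def sum_distrib_right by linarith
  qed
  define U where "U = \<bar>u (sgnval \<nu>)\<bar>"
  define V where "V = \<bar>dI u (sgnval \<nu>)\<bar>"
  have "U > 0" using nz max unfolding U_def by fastforce
  have "V \<ge> 0" by (simp add: V_def)
  have "\<bar>\<alpha> \<nu> 0 * u (sgnval \<nu>) + \<beta> \<nu> 0 * dI u (sgnval \<nu>)\<bar> = \<alpha> \<nu> 0 * U + end_coeff \<nu> * V"
  proof -
    define y where "y = sgnval \<nu> * dI u (sgnval \<nu>)"
    have "\<beta> \<nu> 0 * dI u (sgnval \<nu>) = end_coeff \<nu> * y" "V = \<bar>y\<bar>" "0 \<le> u (sgnval \<nu>) * y"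
      using sign by (cases \<nu>; simp add: end_coeff_def y_def V_def)+
    moreover have "\<bar>a * p + b * q\<bar> = a * \<bar>p\<bar> + b * \<bar>q\<bar>" if "0 \<le> a" "0 \<le> b" "0 \<le> p * q" for a b p q :: real
    proof (cases "0 \<le> p \<and> 0 \<le> q")
      case False
      then have "p \<le> 0 \<and> q \<le> 0" using that(3) by (auto simp: zero_le_mult_iff)
      moreover then have "a * p \<le> 0" "b * q \<le> 0" using that by (auto intro: mult_nonneg_nonpos)
      ultimately show ?thesis by simp
    qed (use that in simp)
    ultimately show ?thesis
      using ph.a0_nonneg[of \<nu>] ph.b0_nonneg[of \<nu>] by (simp add: U_def)
  qed
  with bound[OF max max', of \<nu>, folded U_def V_def]
  have le: "\<alpha> \<nu> 0 * U + end_coeff \<nu> * V \<le> (\<Sum>i=1..m \<nu>. \<bar>\<alpha> \<nu> i\<bar>) * U + (\<Sum>i=1..m \<nu>. \<bar>node_coeff \<nu> i\<bar>) * V" by simp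
  have node_coeff_le: "(\<Sum>i=1..m \<nu>. \<bar>node_coeff \<nu> i\<bar>) * V \<le> end_coeff \<nu> * V"
    using ph.coeff_sum_less(2)[of \<nu>] ph.b_degenerate[of \<nu>] \<open>V \<ge> 0\<close>
    by (intro mult_right_mono) force+
  have \<alpha>0: "\<alpha> \<nu> 0 = 0"
  proof (rule ccontr)
    assume "\<alpha> \<nu> 0 \<noteq> 0"
    then have "(\<Sum>i=1..m \<nu>. \<bar>\<alpha> \<nu> i\<bar>) * U < \<alpha> \<nu> 0 * U"
      using ph.coeff_sum_less(1)[of \<nu>] \<open>U > 0\<close> by simp
    with le node_coeff_le show False by linarith
  qed
  then have "end_coeff \<nu> \<noteq> 0" using ph.a0_b0_pos[of \<nu>] by simp
  have "V = 0"
  proof (rule ccontr)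
    assume "V \<noteq> 0"
    then have "(\<Sum>i=1..m \<nu>. \<bar>node_coeff \<nu> i\<bar>) * V < end_coeff \<nu> * V"
      using ph.coeff_sum_less(2)[of \<nu>] \<open>end_coeff \<nu> \<noteq> 0\<close> \<open>V \<ge> 0\<close> by simp
    moreover have "(\<Sum>i=1..m \<nu>. \<bar>\<alpha> \<nu> i\<bar>) = 0" using \<alpha>0 by (rule ph.a_degenerate)
    ultimately show False using le \<alpha>0 by simp
  qed
  then have flat: "dI u x = 0" if "x \<in> {-1..1}" for x using max'[OF that] by (simp add: V_def)
  have C1: "u \<in> C1_I" using C2 by (simp add: C2_I_def)
  have const: "u x = u (-1)" if "x \<in> {-1..1}" for x
    by (rule constant_on_interval[OF dI_works[OF C1] _ that]) (simp_all add: flat)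
  have c: "u (-1) \<noteq> 0"
  proof -
    obtain x where "x \<in> {-1..1}" "u x \<noteq> 0" using nz by blast
    with const[of x] show ?thesis by simp
  qed
  have "dI (dI u) 0 = 0"
  proof (rule dI_eqI)
    show "(dI u has_real_derivative 0) (at 0 within {-1..1})"
      by (rule has_field_derivative_transform_within[OF DERIV_const[of 0] zero_less_one]) (auto simp: flat)
  qed simp
  then have "lam = 0" using ode[of 0] const[of 0] c by simp
  moreover have "\<alpha> \<nu> 0 = 0" for \<nu>
  proof (rule ccontr)
    assume nz: "\<alpha> \<nu> 0 \<noteq> 0"
    have end_in: "sgnval \<nu> \<in> {-1..1}" by (cases \<nu>) auto
    have "\<bar>\<alpha> \<nu> 0 * u (-1)\<bar> \<le> (\<Sum>i=1..m \<nu>. \<bar>\<alpha> \<nu> i\<bar>) * \<bar>u (-1)\<bar>"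
    proof -
      have "\<bar>u x\<bar> \<le> \<bar>u (-1)\<bar>" if "x \<in> {-1..1}" for x using const[OF that] by simp
      then show ?thesis
        using bound[of "\<bar>u (-1)\<bar>" 0 \<nu>] flat const[OF end_in] flat[OF end_in] by simp
    qed
    also have "\<dots> < \<alpha> \<nu> 0 * \<bar>u (-1)\<bar>"
      using ph.coeff_sum_less(1)[OF nz] c by simp
    finally show False using ph.a0_nonneg[of \<nu>] by (simp add: abs_mult)
  qed
  moreover have "u = on_interval (\<lambda>_. u (-1))"
  proof
    show "u x = on_interval (\<lambda>_. u (-1)) x" for x
      using const[of x] out[of x] by (cases "x \<in> {-1..1}") (simp_all add: on_interval_def)
  qed
  ultimately show ?thesis by blast
qed

lemma on_interval_const_C2:
  fixes c :: real
  shows "on_interval (\<lambda>_. c) \<in> C2_I" "x \<in> {-1..1} \<Longrightarrow> dI (on_interval (\<lambda>_. c)) x = 0"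
    "x \<in> {-1..1} \<Longrightarrow> dI (dI (on_interval (\<lambda>_. c))) x = 0"
  using sine_C2(1)[of c 0 "pi / 2"] sine_C2(2)[of x c 0 "pi / 2"] sine_C2(3)[of x c 0 "pi / 2"] by simp_all

lemma constant_solution:
  assumes "\<And>\<nu>. \<alpha> \<nu> 0 = 0"
  shows "on_interval (\<lambda>_. c) \<in> solutions m \<alpha> \<beta> \<eta> 0"
proof -
  have a: "\<alpha> \<nu> i = 0" if "i \<in> {1..m \<nu>}" for \<nu> i
    using ph.a_degenerate[OF assms] that by (simp add: sum_nonneg_eq_0_iff)
  have "boundary_cond m \<alpha> \<beta> \<eta> \<nu> (on_interval (\<lambda>_. c))" for \<nu>
  proof -
    have "sgnval \<nu> \<in> {-1..1}" by (cases \<nu>) auto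
    then show ?thesis
      using a[of _ \<nu>] node_range[of _ \<nu>] by (simp add: boundary_cond_def assms on_interval_const_C2 del: atLeastAtMost_iff)
  qed
  then show ?thesis
    using on_interval_const_C2 by (auto simp: solutions_def on_interval_def[of _ x for x])
qed

section \<open>Multiplicities and enumeration of the spectrum\<close>

lemma geom_mult_positive:
  assumes s: "0 < s" and k: "gap s = of_int k * pi"
  shows "geom_mult m \<alpha> \<beta> \<eta> (s\<^sup>2) = 1"
proof (rule geom_mult_1I)
  have "u \<in> range (\<lambda>c x. c * wave s x)" if u: "u \<in> solutions m \<alpha> \<beta> \<eta> (s\<^sup>2)" for u
  proof (cases "u \<in> eigenfunctions m \<alpha> \<beta> \<eta> (s\<^sup>2)")
    case True
    then show ?thesis using solution_is_scaled_wave[OF s] by blast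
  next
    case False
    with u have "u = (\<lambda>x. 0 * wave s x)"
      by (force simp: eigenfunctions_def solutions_def)
    then show ?thesis by blast
  qed
  then show "solutions m \<alpha> \<beta> \<eta> (s\<^sup>2) = range (\<lambda>c x. c * wave s x)"
    using scaled_wave_solution[OF s k] by blast
  show "\<exists>x. wave s x \<noteq> 0" using wave_nonzero[OF s] by blast
qed

lemma geom_mult_zero:
  assumes "\<And>\<nu>. \<alpha> \<nu> 0 = 0"
  shows "geom_mult m \<alpha> \<beta> \<eta> 0 = 1"
proof (rule geom_mult_1I[where w = "on_interval (\<lambda>_. 1)"])
  have scale_eq: "on_interval (\<lambda>_. c) = (\<lambda>x. c * on_interval (\<lambda>_. 1) x)" for c
    by (auto simp: on_interval_def)
  have "u \<in> range (\<lambda>c. on_interval (\<lambda>_. c))" if u: "u \<in> solutions m \<alpha> \<beta> \<eta> 0" for u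
  proof (cases "u \<in> eigenfunctions m \<alpha> \<beta> \<eta> 0")
    case True
    then show ?thesis using nonpositive_eigenfunction by blast
  next
    case False
    with u have "u = on_interval (\<lambda>_. 0)"
      by (force simp: eigenfunctions_def solutions_def on_interval_def)
    then show ?thesis by blast
  qed
  then show "solutions m \<alpha> \<beta> \<eta> 0 = range (\<lambda>c x. c * on_interval (\<lambda>_. 1) x)"
    using constant_solution[OF assms] unfolding scale_eq[symmetric] by blast
  have "on_interval (\<lambda>_. 1) 0 = 1" by (simp add: on_interval_def)
  then show "\<exists>x. on_interval (\<lambda>_. 1) x \<noteq> 0" by (metis zero_neq_one)
qed

lemma gap_0_range: "- pi \<le> gap 0" "gap 0 \<le> 0" "gap 0 = 0 \<longleftrightarrow> (\<forall>\<nu>. \<alpha> \<nu> 0 = 0)"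
  using pi_gt_zero unfolding gap_0 all_sign by auto

lemma crossing_0_iff: "crossing k = 0 \<longleftrightarrow> k = 0 \<and> (\<forall>\<nu>. \<alpha> \<nu> 0 = 0)"
proof
  assume "crossing k = 0"
  then have *: "gap 0 = real k * pi" using crossing(2)[of k] by simp
  moreover have "0 \<le> real k * pi" by simp
  ultimately have "gap 0 = 0" using gap_0_range(2) by linarith
  then show "k = 0 \<and> (\<forall>\<nu>. \<alpha> \<nu> 0 = 0)" using * gap_0_range(3) by simp
next
  assume "k = 0 \<and> (\<forall>\<nu>. \<alpha> \<nu> 0 = 0)"
  then show "crossing k = 0" using gap_0_range(3) crossing gap_inj[of "crossing k" 0] by simp
qed

text \<open>
  A positive eigenvalue \<open>s\<^sup>2\<close> has \<open>gap s = k * \<pi>\<close> for an integer \<open>k\<close>, and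
  \<open>gap s > gap 0 \<ge> -\<pi>\<close> excludes negative \<open>k\<close>.
\<close>

lemma spectrum_eq: "spectrum_mp m \<alpha> \<beta> \<eta> = range (\<lambda>k. (crossing k)\<^sup>2)"
proof (intro equalityI subsetI)
  fix lam assume "lam \<in> spectrum_mp m \<alpha> \<beta> \<eta>"
  then obtain u where u: "u \<in> eigenfunctions m \<alpha> \<beta> \<eta> lam" by (auto simp: spectrum_mp_def)
  show "lam \<in> range (\<lambda>k. (crossing k)\<^sup>2)"
  proof (cases "lam \<le> 0")
    case True
    then have "lam = (crossing 0)\<^sup>2"
      using nonpositive_eigenfunction[OF u] crossing_0_iff[of 0] by simp
    then show ?thesis by blast
  next
    case False
    define s where "s = sqrt lam"
    have s: "0 < s" "lam = s\<^sup>2" using False by (auto simp: s_def)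
    obtain k :: int where k: "gap s = of_int k * pi"
      using solution_is_scaled_wave[OF s(1)] u s(2) by blast
    have "- pi < gap s" using gap_monotone[of 0 s] gap_0_range(1) s(1) by linarith
    then have "0 < (of_int k + 1) * pi" using k by (simp add: algebra_simps)
    then have "0 < real_of_int k + 1" by (simp add: zero_less_mult_iff)
    then have "gap s = real (nat k) * pi" using k by simp
    then have "s = crossing (nat k)" using gap_inj[of s "crossing (nat k)"] s(1) crossing[of "nat k"] by simp
    then show ?thesis using s(2) by blast
  qed
next
  fix lam assume "lam \<in> range (\<lambda>k. (crossing k)\<^sup>2)"
  then obtain k where k: "lam = (crossing k)\<^sup>2" by blast
  show "lam \<in> spectrum_mp m \<alpha> \<beta> \<eta>"
  proof (cases "crossing k = 0")
    case True
    then have "on_interval (\<lambda>_. 1) \<in> solutions m \<alpha> \<beta> \<eta> lam"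
      using constant_solution[of 1] crossing_0_iff[of k] k by simp
    then have "on_interval (\<lambda>_. 1) \<in> eigenfunctions m \<alpha> \<beta> \<eta> lam"
      by (auto simp: eigenfunctions_def on_interval_def)
    then show ?thesis by (auto simp: spectrum_mp_def)
  next
    case False
    then have "0 < crossing k" using crossing(1)[of k] by simp
    then show ?thesis
      using wave_eigenfunction[of "crossing k" "int k"] crossing(2)[of k] k by (auto simp: spectrum_mp_def)
  qed
qed

lemma crossing_sq_strict_mono: "strict_mono (\<lambda>k. (crossing k)\<^sup>2)"
  using crossing_strict_mono crossing(1) by (auto simp: strict_mono_def intro: power_strict_mono)

lemma crossing_sq_at_top: "filterlim (\<lambda>k. (crossing k)\<^sup>2) at_top sequentially"
proof (rule filterlim_at_top_mono)
  show "filterlim (\<lambda>k. - 5 + real k) at_top sequentially"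
    by (rule filterlim_tendsto_add_at_top[OF tendsto_const filterlim_real_sequentially])
  show "\<forall>\<^sub>F k in sequentially. - 5 + real k \<le> (crossing k)\<^sup>2"
  proof (intro always_eventually allI)
    fix k
    \<comment> \<open>By \<open>gap_bounds\<close>, \<open>k * \<pi> \<le> 2 * crossing k + \<pi>\<close>; the constant \<open>5\<close> absorbs \<open>\<pi> + 1\<close>.\<close>
    have "real k * 1 \<le> real k * pi" using pi_gt3 by (intro mult_left_mono) auto
    also have "\<dots> \<le> 2 * crossing k + pi" using gap_bounds(2)[OF crossing(1), of k] crossing(2)[of k] by simp
    also have "2 * crossing k \<le> (crossing k)\<^sup>2 + 1"
      using zero_le_power2[of "crossing k - 1"] by (simp add: power2_diff)
    finally show "- 5 + real k \<le> (crossing k)\<^sup>2" using pi_less_4 by linarith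
  qed
qed

end

theorem theorem4p8:
  fixes m :: "sign \<Rightarrow> nat"
    and \<alpha> \<beta> \<eta> :: "sign \<Rightarrow> nat \<Rightarrow> real"
  assumes "\<And>\<nu>. m \<nu> \<ge> 1"
    and "\<And>\<nu> i. i \<in> {1..m \<nu>} \<Longrightarrow> \<eta> \<nu> i \<in> {-1..1}"
    and "\<And>\<nu> i. i \<in> {1..m \<nu>} \<Longrightarrow> \<eta> \<nu> i \<noteq> sgnval \<nu>"
    and "\<And>\<nu>. \<alpha> \<nu> 0 \<ge> 0"
    and "\<And>\<nu>. \<alpha> \<nu> 0 + \<bar>\<beta> \<nu> 0\<bar> > 0"
    and "\<And>\<nu>. sgnval \<nu> * \<beta> \<nu> 0 \<ge> 0"
    and "\<And>\<nu>. coeff_cond m \<alpha> \<beta> \<nu>"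
  shows "\<exists>lam :: nat \<Rightarrow> real.
      spectrum_mp m \<alpha> \<beta> \<eta> = range lam
    \<and> strict_mono lam
    \<and> (\<forall>k. lam k \<ge> 0)
    \<and> filterlim lam at_top sequentially
    \<and> (\<forall>k. geom_mult m \<alpha> \<beta> \<eta> (lam k) = 1)
    \<and> (\<forall>k. lam k > 0 \<longrightarrow> (\<exists>u \<in> eigenfunctions m \<alpha> \<beta> \<eta> (lam k). (lam k, u) \<in> P_plus \<alpha> \<beta> k))
    \<and> (\<alpha> Minus 0 = 0 \<and> \<alpha> Plus 0 = 0 \<longrightarrow> lam 0 = 0)
    \<and> (\<alpha> Minus 0 + \<alpha> Plus 0 > 0 \<longrightarrow> lam 0 > 0)"
proof -
  interpret multi_point m \<alpha> \<beta> \<eta>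
    by unfold_locales (use assms in blast)+
  have pos: "crossing k > 0" if "crossing k \<noteq> 0" for k using crossing(1)[of k] that by simp
  have mult: "geom_mult m \<alpha> \<beta> \<eta> ((crossing k)\<^sup>2) = 1" for k
  proof (cases "crossing k = 0")
    case True
    then show ?thesis using crossing_0_iff[of k] geom_mult_zero by simp
  next
    case False
    then show ?thesis using geom_mult_positive[OF pos, of k "int k"] crossing(2)[of k] by simp
  qed
  have P: "\<exists>u \<in> eigenfunctions m \<alpha> \<beta> \<eta> ((crossing k)\<^sup>2). ((crossing k)\<^sup>2, u) \<in> P_plus \<alpha> \<beta> k"
    if "(crossing k)\<^sup>2 > 0" for k
  proof -
    have "crossing k > 0" using that pos by auto
    then show ?thesis
      using wave_eigenfunction[of "crossing k" "int k"] wave_in_P_plus[of "crossing k" k] crossing(2)[of k] by auto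
  qed
  have "\<alpha> Minus 0 + \<alpha> Plus 0 > 0 \<Longrightarrow> crossing 0 \<noteq> 0"
    unfolding crossing_0_iff all_sign by auto
  moreover have "\<alpha> Minus 0 = 0 \<and> \<alpha> Plus 0 = 0 \<Longrightarrow> crossing 0 = 0"
    unfolding crossing_0_iff all_sign by auto
  ultimately show ?thesis
    by (intro exI[of _ "\<lambda>k. (crossing k)\<^sup>2"] conjI allI impI spectrum_eq crossing_sq_strict_mono
        crossing_sq_at_top zero_le_power2 mult P) auto
qed

end
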